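(* Let $X,Y$ be convergence spaces, let $R=\mathbb{R}$ or $\mathbb{C}$, and let $\mu:[X,R]\to R$ and $\nu:[Y,R]\to R$ be continuous linear functionals. Then there is a unique continuous linear functional $\mu\otimes\nu:[X\times Y,R]\to R$ such that $$\int_y\int_x f(x,y)\,d\mu\,d\nu=\int f\,d(\mu\otimes\nu)=\int_x\int_y f(x,y)\,d\nu\,d\mu$$ for all continuous maps $f:X\times Y\to R$.
   Context: A convergence space is a set $X$ together with an assignment to each point $x\in X$ of a set of proper filters on $X$, said to converge to $x$, such that: (i) the principal ultrafilter $\{A\subseteq X\mid x\in A\}$ converges to $x$; (ii) if $\mathfrak{x}$ converges to $x$ and $\mathfrak{x}\subseteq\mathfrak{y}$ then $\mathfrak{y}$ converges to $x$; (iii) if $\mathfrak{x},\mathfrak{y}$ converge to $x$ then $\mathfrak{x}\cap\mathfrak{y}$ converges to $x$. A map $f:X\to Y$ is continuous if whenever $\mathfrak{x}$ converges to $x$, the image filter $\{B\subseteq Y\mid f^{-1}(B)\in\mathfrak{x}\}$ converges to $f(x)$. Topological spaces are convergence spaces via the usual convergence of filters; $R$ has its usual topology. Products $X\times Y$ are products in the category of convergence spaces (a filter converges to $(x,y)$ iff its image filters under the projections converge to $x$ and $y$). $[X,R]$ is the $R$-vector space of all continuous maps $X\to R$, with pointwise operations and the convergence structure of continuous convergence: a filter $\mathfrak{f}$ converges to $f$ iff for each $x\in X$ and each filter $\mathfrak{x}$ converging to $x$, the image under evaluation $[X,R]\times X\to R$ of the filter generated by $\{A\times B\mid A\in\mathfrak{f},B\in\mathfrak{x}\}$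 converges to $f(x)$. (This is the internal hom in the cartesian closed category of convergence spaces.) For a continuous linear functional $\mu:[X,R]\to R$ and $f\in[X,R]$, write $\int_x f(x)\,d\mu:=\int f\,d\mu:=\mu(f)$. *)

theory Defs
  imports Complex_Main "HOL-Library.FuncSet"
begin

text \<open>
  A filter on a set \<open>S\<close> is an element \<open>F\<close> of \<^typ>\<open>'a filter\<close> with \<open>F \<le> principal S\<close>; it is
  proper if \<open>F \<noteq> bot\<close>.  The order of \<^typ>\<open>'a filter\<close> is the reverse of inclusion of the
  families of sets, so \<open>G \<le> F\<close> says that \<open>G\<close> is finer than \<open>F\<close>, and the intersection of
  two filters is \<open>sup F G\<close>.
\<close>

definition proper_filter_on :: "'a set \<Rightarrow> 'a filter \<Rightarrow> bool" where
  "proper_filter_on S F \<longleftrightarrow> F \<noteq> bot \<and> F \<le> principal S"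

record 'a conv_space =
  points :: "'a set"
  converges :: "'a filter \<Rightarrow> 'a \<Rightarrow> bool"

locale convergence_space =
  fixes X :: "'a conv_space"
  assumes converges_proper:
      "converges X F x \<Longrightarrow> x \<in> points X \<and> proper_filter_on (points X) F"
    and converges_point: "x \<in> points X \<Longrightarrow> converges X (principal {x}) x"
    and converges_finer:
      "converges X F x \<Longrightarrow> G \<le> F \<Longrightarrow> proper_filter_on (points X) G \<Longrightarrow> converges X G x"
    and converges_sup: "converges X F x \<Longrightarrow> converges X G x \<Longrightarrow> converges X (sup F G) x"

text \<open>
  Maps out of a space are extensional functions on its set of points, so that equality of
  functions is equality of maps.
\<close>

definition continuous_maps :: "'a conv_space \<Rightarrow> 'b conv_space \<Rightarrow> ('a \<Rightarrow> 'b) set" where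
  "continuous_maps X Y =
     {f \<in> points X \<rightarrow>\<^sub>E points Y.
        \<forall>x F. converges X F x \<longrightarrow> converges Y (filtermap f F) (f x)}"

definition topological_conv_space :: "'a::topological_space conv_space" where
  "topological_conv_space =
     \<lparr>points = UNIV, converges = (\<lambda>F x. F \<noteq> bot \<and> F \<le> nhds x)\<rparr>"

definition prod_conv_space :: "'a conv_space \<Rightarrow> 'b conv_space \<Rightarrow> ('a \<times> 'b) conv_space" where
  "prod_conv_space X Y =
     \<lparr>points = points X \<times> points Y,
      converges = (\<lambda>F p. proper_filter_on (points X \<times> points Y) F \<and>
        converges X (filtermap fst F) (fst p) \<and> converges Y (filtermap snd F) (snd p))\<rparr>"

definition fun_conv_space :: "'a conv_space \<Rightarrow> 'b conv_space \<Rightarrow> ('a \<Rightarrow> 'b) conv_space" where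
  "fun_conv_space X Y =
     \<lparr>points = continuous_maps X Y,
      converges = (\<lambda>\<Phi> f. f \<in> continuous_maps X Y \<and>
        proper_filter_on (continuous_maps X Y) \<Phi> \<and>
        (\<forall>x F. converges X F x \<longrightarrow>
           converges Y (filtermap (\<lambda>(g, z). g z) (\<Phi> \<times>\<^sub>F F)) (f x)))\<rparr>"

abbreviation scalar_maps :: "'a conv_space \<Rightarrow> ('a \<Rightarrow> 'k::real_normed_field) set" where
  "scalar_maps X \<equiv> continuous_maps X topological_conv_space"

definition continuous_linear_functional ::
    "'a conv_space \<Rightarrow> (('a \<Rightarrow> 'k::real_normed_field) \<Rightarrow> 'k) \<Rightarrow> bool" where
  "continuous_linear_functional X \<mu> \<longleftrightarrow>
     \<mu> \<in> continuous_maps (fun_conv_space X topological_conv_space) topological_conv_space \<and>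
     (\<forall>f \<in> scalar_maps X. \<forall>g \<in> scalar_maps X.
        \<mu> (\<lambda>x\<in>points X. f x + g x) = \<mu> f + \<mu> g) \<and>
     (\<forall>c. \<forall>f \<in> scalar_maps X. \<mu> (\<lambda>x\<in>points X. c * f x) = c * \<mu> f)"

lemma convergence_space_topological: "convergence_space topological_conv_space"
proof
  fix x :: 'a
  have "principal {x} \<le> nhds x"
    by (auto simp: le_filter_def eventually_principal dest: eventually_nhds_x_imp_x)
  then show "converges topological_conv_space (principal {x}) x"
    by (simp add: topological_conv_space_def principal_eq_bot_iff)
qed (auto simp: topological_conv_space_def proper_filter_on_def)

lemma convergence_space_prod:
  assumes "convergence_space X" "convergence_space Y"
  shows "convergence_space (prod_conv_space X Y)"
proof -
  interpret X: convergence_space X by fact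
  interpret Y: convergence_space Y by fact
  show ?thesis
  proof
    fix F p
    assume "converges (prod_conv_space X Y) F p"
    then show "p \<in> points (prod_conv_space X Y) \<and>
        proper_filter_on (points (prod_conv_space X Y)) F"
      using X.converges_proper Y.converges_proper
      by (cases p) (auto simp: prod_conv_space_def)
  next
    fix p
    assume "p \<in> points (prod_conv_space X Y)"
    then show "converges (prod_conv_space X Y) (principal {p}) p"
      using X.converges_point Y.converges_point
      by (auto simp: prod_conv_space_def proper_filter_on_def filtermap_principal
          principal_eq_bot_iff)
  next
    fix F G p
    assume F: "converges (prod_conv_space X Y) F p" and "G \<le> F"
      and G: "proper_filter_on (points (prod_conv_space X Y)) G"
    have "proper_filter_on (points X) (filtermap fst G)"
         "proper_filter_on (points Y) (filtermap snd G)"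
      using G filtermap_mono[of G "principal (points X \<times> points Y)" fst]
        filtermap_mono[of G "principal (points X \<times> points Y)" snd]
      by (auto simp: prod_conv_space_def proper_filter_on_def filtermap_bot_iff
          filtermap_principal le_principal eventually_filtermap elim: eventually_mono)
    then show "converges (prod_conv_space X Y) G p"
      using F G X.converges_finer[OF _ filtermap_mono[OF \<open>G \<le> F\<close>]]
        Y.converges_finer[OF _ filtermap_mono[OF \<open>G \<le> F\<close>]]
      by (simp add: prod_conv_space_def)
  next
    fix F G p
    assume "converges (prod_conv_space X Y) F p" "converges (prod_conv_space X Y) G p"
    then show "converges (prod_conv_space X Y) (sup F G) p"
      using X.converges_sup Y.converges_sup
      by (auto simp: prod_conv_space_def proper_filter_on_def filtermap_sup)
  qed
qed

lemma convergence_space_fun: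
  assumes "convergence_space X" "convergence_space Y"
  shows "convergence_space (fun_conv_space X Y)"
proof -
  interpret X: convergence_space X by fact
  interpret Y: convergence_space Y by fact
  let ?ev = "\<lambda>(g :: 'a \<Rightarrow> 'b, z). g z"
  show ?thesis
  proof
    fix \<Phi> f
    assume "converges (fun_conv_space X Y) \<Phi> f"
    then show "f \<in> points (fun_conv_space X Y) \<and>
        proper_filter_on (points (fun_conv_space X Y)) \<Phi>"
      by (simp add: fun_conv_space_def)
  next
    fix f
    assume "f \<in> points (fun_conv_space X Y)"
    moreover have "filtermap ?ev (principal {f} \<times>\<^sub>F F) = filtermap f F" for F
      by (simp add: prod_filter_principal_singleton filtermap_filtermap)
    ultimately show "converges (fun_conv_space X Y) (principal {f}) f"
      by (simp add: fun_conv_space_def continuous_maps_def proper_filter_on_def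
          principal_eq_bot_iff)
  next
    fix \<Phi> \<Psi> f
    assume \<Phi>: "converges (fun_conv_space X Y) \<Phi> f" and "\<Psi> \<le> \<Phi>"
      and \<Psi>: "proper_filter_on (points (fun_conv_space X Y)) \<Psi>"
    have "converges Y (filtermap ?ev (\<Psi> \<times>\<^sub>F F)) (f x)" if F: "converges X F x" for x F
    proof (rule Y.converges_finer)
      show \<Phi>F: "converges Y (filtermap ?ev (\<Phi> \<times>\<^sub>F F)) (f x)"
        using \<Phi> F by (simp add: fun_conv_space_def)
      show le: "filtermap ?ev (\<Psi> \<times>\<^sub>F F) \<le> filtermap ?ev (\<Phi> \<times>\<^sub>F F)"
        by (intro filtermap_mono prod_filter_mono \<open>\<Psi> \<le> \<Phi>\<close> order_refl)
      have "filtermap ?ev (\<Psi> \<times>\<^sub>F F) \<noteq> bot"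
        using \<Psi> X.converges_proper[OF F]
        by (simp add: proper_filter_on_def filtermap_bot_iff prod_filter_eq_bot)
      then show "proper_filter_on (points Y) (filtermap ?ev (\<Psi> \<times>\<^sub>F F))"
        using Y.converges_proper[OF \<Phi>F] le order_trans
        unfolding proper_filter_on_def by blast
    qed
    then show "converges (fun_conv_space X Y) \<Psi> f"
      using \<Phi> \<Psi> by (simp add: fun_conv_space_def)
  next
    fix \<Phi> \<Psi> f
    assume \<Phi>: "converges (fun_conv_space X Y) \<Phi> f"
      and \<Psi>: "converges (fun_conv_space X Y) \<Psi> f"
    have "converges Y (filtermap ?ev (sup \<Phi> \<Psi> \<times>\<^sub>F F)) (f x)" if F: "converges X F x" for x F
    proof (rule Y.converges_finer)
      show sup: "converges Y (sup (filtermap ?ev (\<Phi> \<times>\<^sub>F F)) (filtermap ?ev (\<Psi> \<times>\<^sub>F F))) (f x)"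
        using \<Phi> \<Psi> F by (intro Y.converges_sup) (simp_all add: fun_conv_space_def)
      have "sup \<Phi> \<Psi> \<times>\<^sub>F F \<le> sup (\<Phi> \<times>\<^sub>F F) (\<Psi> \<times>\<^sub>F F)"
      proof (rule filter_leI)
        fix P
        assume "eventually P (sup (\<Phi> \<times>\<^sub>F F) (\<Psi> \<times>\<^sub>F F))"
        then obtain P1 Q1 P2 Q2
          where "eventually P1 \<Phi>" "eventually Q1 F" "\<And>g z. P1 g \<Longrightarrow> Q1 z \<Longrightarrow> P (g, z)"
            and "eventually P2 \<Psi>" "eventually Q2 F" "\<And>g z. P2 g \<Longrightarrow> Q2 z \<Longrightarrow> P (g, z)"
          unfolding eventually_sup eventually_prod_filter by blast
        then show "eventually P (sup \<Phi> \<Psi> \<times>\<^sub>F F)"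
          unfolding eventually_sup eventually_prod_filter
          by (intro exI[of _ "\<lambda>g. P1 g \<or> P2 g"] exI[of _ "\<lambda>z. Q1 z \<and> Q2 z"])
            (auto elim: eventually_mono intro: eventually_conj)
      qed
      then show le: "filtermap ?ev (sup \<Phi> \<Psi> \<times>\<^sub>F F)
          \<le> sup (filtermap ?ev (\<Phi> \<times>\<^sub>F F)) (filtermap ?ev (\<Psi> \<times>\<^sub>F F))"
        by (metis filtermap_mono filtermap_sup)
      have "filtermap ?ev (sup \<Phi> \<Psi> \<times>\<^sub>F F) \<noteq> bot"
        using \<Phi> X.converges_proper[OF F]
        by (auto simp: fun_conv_space_def proper_filter_on_def filtermap_bot_iff
            prod_filter_eq_bot)
      then show "proper_filter_on (points Y) (filtermap ?ev (sup \<Phi> \<Psi> \<times>\<^sub>F F))"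
        using Y.converges_proper[OF sup] le order_trans
        unfolding proper_filter_on_def by blast
    qed
    then show "converges (fun_conv_space X Y) (sup \<Phi> \<Psi>) f"
      using \<Phi> \<Psi> by (auto simp: fun_conv_space_def proper_filter_on_def)
  qed
qed

lemma filtermap_eqI:
  assumes "eventually (\<lambda>x. f x = g x) F"
  shows "filtermap f F = filtermap g F"
proof (rule filter_eqI)
  fix P
  show "eventually P (filtermap f F) = eventually P (filtermap g F)"
    unfolding eventually_filtermap 
    by (rule eventually_cong[OF assms]) simp
qed

lemma prod_filter_converges:
  assumes "convergence_space X" "convergence_space Y"
    and F: "converges X F x" and G: "converges Y G y"
  shows "converges (prod_conv_space X Y) (F \<times>\<^sub>F G) (x, y)"
proof -
  interpret X: convergence_space X by fact
  interpret Y: convergence_space Y by fact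
  have F': "F \<noteq> bot" "F \<le> principal (points X)" and G': "G \<noteq> bot" "G \<le> principal (points Y)"
    using X.converges_proper[OF F] Y.converges_proper[OF G]
    by (auto simp: proper_filter_on_def)
  have "F \<times>\<^sub>F G \<le> principal (points X \<times> points Y)"
    using prod_filter_mono[OF F'(2) G'(2)] by (simp add: principal_prod_principal)
  moreover have "converges X (filtermap fst (F \<times>\<^sub>F G)) x"
    using F'(1) G'(1) order_trans[OF filtermap_fst_prod_filter F'(2)]
    by (intro X.converges_finer[OF F filtermap_fst_prod_filter])
      (simp add: proper_filter_on_def filtermap_bot_iff prod_filter_eq_bot)
  moreover have "converges Y (filtermap snd (F \<times>\<^sub>F G)) y"
    using F'(1) G'(1) order_trans[OF filtermap_snd_prod_filter G'(2)]
    by (intro Y.converges_finer[OF G filtermap_snd_prod_filter])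
      (simp add: proper_filter_on_def filtermap_bot_iff prod_filter_eq_bot)
  ultimately show ?thesis
    using F'(1) G'(1)
    by (simp add: prod_conv_space_def proper_filter_on_def prod_filter_eq_bot)
qed

lemma continuous_maps_section:
  assumes "convergence_space X" "convergence_space Y"
    and f: "f \<in> continuous_maps (prod_conv_space X Y) Z" and y: "y \<in> points Y"
  shows "(\<lambda>x\<in>points X. f (x, y)) \<in> continuous_maps X Z"
proof -
  interpret X: convergence_space X by fact
  interpret Y: convergence_space Y by fact
  have "converges Z (filtermap (\<lambda>x\<in>points X. f (x, y)) F) (f (x, y))"
    if F: "converges X F x" for x F
  proof -
    have "eventually (\<lambda>x. x \<in> points X) F"
      using X.converges_proper[OF F] by (simp add: proper_filter_on_def le_principal)
    then have "filtermap (\<lambda>x\<in>points X. f (x, y)) F = filtermap (\<lambda>x. f (x, y)) F"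
      by (intro filtermap_eqI) (auto elim!: eventually_mono)
    also have "\<dots> = filtermap f (F \<times>\<^sub>F principal {y})"
      by (simp add: prod_filter_principal_singleton2 filtermap_filtermap)
    finally show ?thesis
      using f prod_filter_converges[OF assms(1,2) F Y.converges_point[OF y]]
      by (simp add: continuous_maps_def)
  qed
  then show ?thesis
    using f y X.converges_proper
    by (fastforce simp: continuous_maps_def prod_conv_space_def)
qed

lemma continuous_maps_curry:
  assumes "convergence_space X" "convergence_space Y"
    and f: "f \<in> continuous_maps (prod_conv_space X Y) Z"
  shows "(\<lambda>y\<in>points Y. \<lambda>x\<in>points X. f (x, y)) \<in> continuous_maps Y (fun_conv_space X Z)"
    (is "?c \<in> _")
proof -
  interpret X: convergence_space X by fact
  interpret Y: convergence_space Y by fact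
  note sec = continuous_maps_section[OF assms]
  have "converges (fun_conv_space X Z) (filtermap ?c G) (?c y)" if G: "converges Y G y" for y G
  proof -
    have y: "y \<in> points Y" and Gn: "G \<noteq> bot" and GY: "eventually (\<lambda>y. y \<in> points Y) G"
      using Y.converges_proper[OF G] by (auto simp: proper_filter_on_def le_principal)
    have "filtermap ?c G \<le> principal (continuous_maps X Z)"
      unfolding le_principal eventually_filtermap
      by (rule eventually_mono[OF GY]) (simp add: sec)
    moreover have "converges Z (filtermap (\<lambda>(g, z). g z) (filtermap ?c G \<times>\<^sub>F F)) (?c y x)"
      if F: "converges X F x" for x F
    proof -
      have x: "x \<in> points X" and FX: "eventually (\<lambda>x. x \<in> points X) F"
        using X.converges_proper[OF F] by (auto simp: proper_filter_on_def le_principal)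
      have "eventually (\<lambda>(x, y). x \<in> points X \<and> y \<in> points Y) (F \<times>\<^sub>F G)"
        using FX GY by (auto simp: eventually_prod_filter)
      then have "filtermap (\<lambda>(x, y). ?c y x) (F \<times>\<^sub>F G) = filtermap f (F \<times>\<^sub>F G)"
        by (intro filtermap_eqI) (auto elim!: eventually_mono)
      moreover have "filtermap (\<lambda>(g, z). g z) (filtermap ?c G \<times>\<^sub>F F)
          = filtermap (\<lambda>(x, y). ?c y x) (F \<times>\<^sub>F G)"
        by (subst (2) prod_filter_commute)
          (simp add: prod_filtermap1 filtermap_filtermap case_prod_unfold del: restrict_apply)
      ultimately show ?thesis
        using f prod_filter_converges[OF assms(1,2) F G] x y
        by (simp add: continuous_maps_def)
    qed
    ultimately show ?thesis
      using sec[OF y] y Gn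
      by (simp add: fun_conv_space_def proper_filter_on_def filtermap_bot_iff)
  qed
  moreover have "?c \<in> points Y \<rightarrow>\<^sub>E points (fun_conv_space X Z)"
    using sec by (simp add: fun_conv_space_def)
  ultimately show ?thesis
    unfolding continuous_maps_def by blast
qed

text \<open>
  Integrating out one variable of a continuous map on the product yields a continuous map, so
  the outer functional of an iterated integral is applied to an element of its domain.  This is
  shown for the first variable; the second is symmetric.
\<close>

lemma continuous_maps_partial_integral:
  assumes "convergence_space X" "convergence_space Y"
    and f: "f \<in> scalar_maps (prod_conv_space X Y)"
    and \<mu>: "continuous_linear_functional X \<mu>"
  shows "(\<lambda>y\<in>points Y. \<mu> (\<lambda>x\<in>points X. f (x, y))) \<in> scalar_maps Y"
proof -
  interpret Y: convergence_space Y by fact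
  let ?c = "\<lambda>y\<in>points Y. \<lambda>x\<in>points X. f (x, y)"
  let ?I = "\<lambda>y\<in>points Y. \<mu> (\<lambda>x\<in>points X. f (x, y))"
  have "converges topological_conv_space (filtermap ?I G) (?I y)" if G: "converges Y G y" for y G
  proof -
    have y: "y \<in> points Y" and "eventually (\<lambda>y. y \<in> points Y) G"
      using Y.converges_proper[OF G] by (auto simp: proper_filter_on_def le_principal)
    then have "filtermap ?I G = filtermap \<mu> (filtermap ?c G)"
      unfolding filtermap_filtermap
      by (intro filtermap_eqI) (erule eventually_mono, simp)
    moreover have "converges topological_conv_space (filtermap \<mu> (filtermap ?c G)) (\<mu> (?c y))"
      using continuous_maps_curry[OF assms(1,2) f] \<mu> G
      unfolding continuous_linear_functional_def continuous_maps_def by blast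
    ultimately show ?thesis
      using y by simp
  qed
  moreover have "?I \<in> points Y \<rightarrow>\<^sub>E points topological_conv_space"
    by (simp add: topological_conv_space_def)
  ultimately show ?thesis
    unfolding continuous_maps_def by blast
qed

end

theory Submission
  imports Defs "HOL-Analysis.Weierstrass_Theorems"
begin

text \<open>
  Both iterated integrals are continuous linear functionals on the function space of the product,
  and they agree on the tensors \<open>g x * h y\<close>.  A Stone--Weierstrass argument shows that a
  continuous linear functional \<open>D\<close> vanishing on all tensors is zero.  The functions annihilated by
  every such \<open>D\<close> form a vector lattice, which contains
  \<open>f (u, y) + f (x', v) - f (x', y)\<close>, a function of \<open>(u, v)\<close> that agrees with \<open>f\<close> at \<open>(x, y)\<close> and at
  \<open>(x', y')\<close>.  The compactness required to pass to finite maxima and minima comes from \<open>D\<close>: continuous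
  convergence forces \<open>D\<close> to depend only on the restriction to finitely many members of any system
  of sets that meets all convergent filters.  Complex functionals are reduced to the real case by
  taking real and imaginary parts.
\<close>

text \<open>Uniqueness is immediate, since the required identities prescribe the value of the
  functional at every continuous map; the content is the equality of the two iterated integrals. On
  compact spaces it would follow from uniform density of the sums of tensors. Here neither
  compactness nor a uniform norm is at hand, so density is never shown: approximation takes place
  only as far as one fixed functional \<open>D\<close> that annihilates the tensors can see. This
  shapes the two passages to finite extrema. The finite family obtained from a covering system
  depends on that system, so the maxima built for different points come with different regions on
  which \<open>D\<close> lives. The lower estimate that they give is therefore not kept on a set,
  but in the form that \<open>D\<close> vanishes on every continuous function dominated by the
  deficit. The final error is measured with a single constant, fixed before the accuracy is
  chosen.\<close>

subsection \<open>Functionals bounded on covering systems\<close>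

text \<open>
  Continuity of a total function at the points of \<open>Z\<close>; its values elsewhere are irrelevant, which
  avoids extensionality in algebraic manipulations.
\<close>

definition conv_cont :: "'a conv_space \<Rightarrow> ('a \<Rightarrow> 'k::topological_space) \<Rightarrow> bool" where
  "conv_cont Z f \<longleftrightarrow> (\<forall>F x. converges Z F x \<longrightarrow> (f \<longlongrightarrow> f x) F)"

text \<open>For a topological space this says that every point has a neighbourhood among the
  members. In general the member may depend on the filter and not only on its limit.\<close>

definition cover_system :: "'a conv_space \<Rightarrow> 'a set set \<Rightarrow> bool" where
  "cover_system Z \<A> \<longleftrightarrow> (\<forall>F x. converges Z F x \<longrightarrow> (\<exists>A\<in>\<A>. eventually (\<lambda>z. z \<in> A) F))"

text \<open>
  The trace of continuity that the density argument needs: for every covering system, a continuous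
  linear functional is bounded by a multiple of the supremum norm on the union of finitely many of
  its members.  The multiple depends on these members, but taking \<open>{UNIV}\<close> as the system yields
  one that serves all bounded functions.
\<close>

definition cover_bounded ::
    "'a conv_space \<Rightarrow> (('a \<Rightarrow> 'k::real_normed_field) \<Rightarrow> 'k) \<Rightarrow> bool" where
  "cover_bounded Z D \<longleftrightarrow>
     (\<forall>f g. conv_cont Z f \<longrightarrow> conv_cont Z g \<longrightarrow> D (\<lambda>z. f z + g z) = D f + D g) \<and>
     (\<forall>c f. conv_cont Z f \<longrightarrow> D (\<lambda>z. c * f z) = c * D f) \<and>
     (\<forall>\<A>. cover_system Z \<A> \<longrightarrow>
        (\<exists>\<K>\<subseteq>\<A>. finite \<K> \<and> (\<exists>C\<ge>0. \<forall>e\<ge>0. \<forall>g. conv_cont Z g \<longrightarrow>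
           (\<forall>z\<in>\<Union>\<K>. norm (g z) \<le> e) \<longrightarrow> norm (D g) \<le> C * e)))"

lemma conv_cont_const [intro]: "conv_cont Z (\<lambda>z. c)"
  by (simp add: conv_cont_def)

lemma conv_cont_add [intro]:
  fixes f g :: "'a \<Rightarrow> 'k::real_normed_vector"
  shows "conv_cont Z f \<Longrightarrow> conv_cont Z g \<Longrightarrow> conv_cont Z (\<lambda>z. f z + g z)"
  by (auto simp: conv_cont_def intro: tendsto_add)

lemma conv_cont_diff [intro]:
  fixes f g :: "'a \<Rightarrow> 'k::real_normed_vector"
  shows "conv_cont Z f \<Longrightarrow> conv_cont Z g \<Longrightarrow> conv_cont Z (\<lambda>z. f z - g z)"
  by (auto simp: conv_cont_def intro: tendsto_diff)

lemma conv_cont_mult [intro]: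
  fixes f g :: "'a \<Rightarrow> 'k::real_normed_field"
  shows "conv_cont Z f \<Longrightarrow> conv_cont Z g \<Longrightarrow> conv_cont Z (\<lambda>z. f z * g z)"
  by (auto simp: conv_cont_def intro: tendsto_mult)

lemma conv_cont_max [intro]:
  fixes f g :: "'a \<Rightarrow> real"
  shows "conv_cont Z f \<Longrightarrow> conv_cont Z g \<Longrightarrow> conv_cont Z (\<lambda>z. max (f z) (g z))"
  by (auto simp: conv_cont_def intro: tendsto_max)

lemma conv_cont_min [intro]:
  fixes f g :: "'a \<Rightarrow> real"
  shows "conv_cont Z f \<Longrightarrow> conv_cont Z g \<Longrightarrow> conv_cont Z (\<lambda>z. min (f z) (g z))"
  by (auto simp: conv_cont_def intro: tendsto_min)

lemma cover_boundedE:
  assumes "cover_bounded Z D" "cover_system Z \<A>"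
  obtains \<K> C where "\<K> \<subseteq> \<A>" "finite \<K>" "C \<ge> 0"
    "\<And>e g. e \<ge> 0 \<Longrightarrow> conv_cont Z g \<Longrightarrow> (\<And>z. z \<in> \<Union>\<K> \<Longrightarrow> norm (g z) \<le> e) \<Longrightarrow> norm (D g) \<le> C * e"
  using assms unfolding cover_bounded_def by metis

lemma cover_bounded_add:
  "cover_bounded Z D \<Longrightarrow> conv_cont Z f \<Longrightarrow> conv_cont Z g \<Longrightarrow> D (\<lambda>z. f z + g z) = D f + D g"
  by (simp add: cover_bounded_def)

lemma cover_bounded_cmult:
  "cover_bounded Z D \<Longrightarrow> conv_cont Z f \<Longrightarrow> D (\<lambda>z. c * f z) = c * D f"
  by (simp add: cover_bounded_def)

lemma cover_bounded_diff:
  assumes "cover_bounded Z D" "conv_cont Z f" "conv_cont Z g"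
  shows "D (\<lambda>z. f z - g z) = D f - D g"
proof -
  have "D (\<lambda>z. f z + (- 1) * g z) = D f + (- 1) * D g"
    using assms by (subst cover_bounded_add[OF assms(1)]) (auto simp only: cover_bounded_cmult)
  then show ?thesis
    by simp
qed

lemma cover_bounded_diff_functional:
  assumes "cover_bounded Z D" "cover_bounded Z E"
  shows "cover_bounded Z (\<lambda>g. D g - E g)"
proof -
  have "\<exists>\<K>\<subseteq>\<A>. finite \<K> \<and> (\<exists>C\<ge>0. \<forall>e\<ge>0. \<forall>g. conv_cont Z g \<longrightarrow>
           (\<forall>z\<in>\<Union>\<K>. norm (g z) \<le> e) \<longrightarrow> norm (D g - E g) \<le> C * e)"
    if \<A>: "cover_system Z \<A>" for \<A>
  proof -
    obtain K1 C1 where 1: "K1 \<subseteq> \<A>" "finite K1" "C1 \<ge> 0"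
      "\<And>e g. e \<ge> 0 \<Longrightarrow> conv_cont Z g \<Longrightarrow> (\<And>z. z \<in> \<Union>K1 \<Longrightarrow> norm (g z) \<le> e) \<Longrightarrow> norm (D g) \<le> C1 * e"
      using cover_boundedE[OF assms(1) \<A>] by metis
    obtain K2 C2 where 2: "K2 \<subseteq> \<A>" "finite K2" "C2 \<ge> 0"
      "\<And>e g. e \<ge> 0 \<Longrightarrow> conv_cont Z g \<Longrightarrow> (\<And>z. z \<in> \<Union>K2 \<Longrightarrow> norm (g z) \<le> e) \<Longrightarrow> norm (E g) \<le> C2 * e"
      using cover_boundedE[OF assms(2) \<A>] by metis
    have "norm (D g - E g) \<le> (C1 + C2) * e"
      if "e \<ge> 0" "conv_cont Z g" "\<forall>z\<in>\<Union>(K1 \<union> K2). norm (g z) \<le> e" for e g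
    proof -
      have "norm (D g) \<le> C1 * e" "norm (E g) \<le> C2 * e"
        using that by (auto intro!: 1(4) 2(4))
      then show ?thesis
        using norm_triangle_ineq4[of "D g" "E g"] by (simp add: distrib_right)
    qed
    then show ?thesis
      using 1(1-3) 2(1-3)
      by (intro exI[of _ "K1 \<union> K2"] conjI exI[of _ "C1 + C2"]) auto
  qed
  then show ?thesis
    using assms by (auto simp: cover_bounded_def algebra_simps)
qed

text \<open>Multiplication by \<open>t\<close> need not preserve bounds, as \<open>t\<close> may be
  unbounded. Cutting the members of the system down to sublevel sets of \<open>norm (t z)\<close>
  leaves a covering system, because \<open>t\<close> is bounded along every convergent filter; on
  finitely many of the smaller sets \<open>t\<close> is bounded.\<close>

lemma cover_bounded_mult:
  assumes D: "cover_bounded Z D" and t: "conv_cont Z t"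
  shows "cover_bounded Z (\<lambda>g. D (\<lambda>z. t z * g z))"
proof -
  have "\<exists>\<K>\<subseteq>\<A>. finite \<K> \<and> (\<exists>C\<ge>0. \<forall>e\<ge>0. \<forall>g. conv_cont Z g \<longrightarrow>
           (\<forall>z\<in>\<Union>\<K>. norm (g z) \<le> e) \<longrightarrow> norm (D (\<lambda>z. t z * g z)) \<le> C * e)"
    if \<A>: "cover_system Z \<A>" for \<A>
  proof -
    let ?S = "\<lambda>(A, M). A \<inter> {z. norm (t z) \<le> M}"
    have "cover_system Z (?S ` (\<A> \<times> {0..}))"
      unfolding cover_system_def
    proof (intro allI impI)
      fix F x assume F: "converges Z F x"
      then obtain A where A: "A \<in> \<A>" "eventually (\<lambda>z. z \<in> A) F"
        using \<A> unfolding cover_system_def by blast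
      have "((\<lambda>z. norm (t z)) \<longlongrightarrow> norm (t x)) F"
        using t F by (auto simp: conv_cont_def intro: tendsto_norm)
      then have "eventually (\<lambda>z. norm (t z) < norm (t x) + 1) F"
        by (rule order_tendstoD) simp
      with A(2) have "eventually (\<lambda>z. z \<in> ?S (A, norm (t x) + 1)) F"
        by eventually_elim simp
      then show "\<exists>A\<in>?S ` (\<A> \<times> {0..}). eventually (\<lambda>z. z \<in> A) F"
        using A(1) by (intro bexI[of _ "?S (A, norm (t x) + 1)"] imageI) auto
    qed
    then obtain K C where K: "K \<subseteq> ?S ` (\<A> \<times> {0..})" "finite K" "C \<ge> 0"
      "\<And>e g. e \<ge> 0 \<Longrightarrow> conv_cont Z g \<Longrightarrow> (\<And>z. z \<in> \<Union>K \<Longrightarrow> norm (g z) \<le> e) \<Longrightarrow> norm (D g) \<le> C * e"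
      using cover_boundedE[OF D] by metis
    obtain J where J: "J \<subseteq> \<A> \<times> {0..}" "finite J" "K = ?S ` J"
      using finite_subset_image[OF K(2,1)] by blast
    \<comment> \<open>The sum of finitely many non-negative bounds dominates each of them and,
      unlike their maximum, makes sense for an empty family.\<close>
    define M where "M = (\<Sum>j\<in>J. snd j)"
    have M: "snd j \<le> M" if "j \<in> J" for j
      unfolding M_def using J that by (intro member_le_sum) auto
    have M0: "M \<ge> 0"
      unfolding M_def using J(1) by (intro sum_nonneg) auto
    have "norm (D (\<lambda>z. t z * g z)) \<le> (C * M) * e"
      if e: "e \<ge> 0" and g: "conv_cont Z g" and le: "\<forall>z\<in>\<Union>(fst ` J). norm (g z) \<le> e" for e g
    proof -
      have "norm (t z * g z) \<le> M * e" if z: "z \<in> \<Union>K" for z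
      proof -
        obtain j where "j \<in> J" "z \<in> ?S j"
          using z J(3) by blast
        then have j: "j \<in> J" "z \<in> fst j" "norm (t z) \<le> snd j"
          by (auto simp: case_prod_unfold)
        then have "norm (t z) \<le> M" "norm (g z) \<le> e"
          using M[OF j(1)] le by auto
        then show ?thesis
          using M0 by (simp add: norm_mult mult_mono)
      qed
      then have "norm (D (\<lambda>z. t z * g z)) \<le> C * (M * e)"
        using M0 e g t by (intro K(4)) auto
      then show ?thesis
        by (simp add: mult.assoc)
    qed
    moreover have "fst ` J \<subseteq> \<A>"
      using J(1) by auto
    ultimately show ?thesis
      using J(2) M0 K(3)
      by (intro exI[of _ "fst ` J"] conjI exI[of _ "C * M"]) auto
  qed
  moreover have "D (\<lambda>z. t z * (f z + g z)) = D (\<lambda>z. t z * f z) + D (\<lambda>z. t z * g z)"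
    if "conv_cont Z f" "conv_cont Z g" for f g
    using cover_bounded_add[OF D conv_cont_mult[OF t that(1)] conv_cont_mult[OF t that(2)]]
    by (simp add: distrib_left)
  moreover have "D (\<lambda>z. t z * (c * f z)) = c * D (\<lambda>z. t z * f z)"
    if "conv_cont Z f" for c f
    using cover_bounded_cmult[OF D conv_cont_mult[OF t that(1)], of c]
    by (simp add: mult.left_commute)
  ultimately show ?thesis
    unfolding cover_bounded_def by simp
qed

subsection \<open>A Stone--Weierstrass theorem\<close>

text \<open>The annihilator of the annihilator of \<open>T\<close>, in the pairing of continuous
  functions with cover-bounded functionals. It takes the place of the closed linear span of
  \<open>T\<close>.\<close>

definition bipolar :: "'a conv_space \<Rightarrow> ('a \<Rightarrow> real) set \<Rightarrow> ('a \<Rightarrow> real) set" where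
  "bipolar Z T =
     {f. conv_cont Z f \<and> (\<forall>D. cover_bounded Z D \<longrightarrow> (\<forall>t\<in>T. D t = 0) \<longrightarrow> D f = 0)}"

lemma bipolar_cont: "f \<in> bipolar Z T \<Longrightarrow> conv_cont Z f"
  by (simp add: bipolar_def)

lemma bipolar_superset: "t \<in> T \<Longrightarrow> conv_cont Z t \<Longrightarrow> t \<in> bipolar Z T"
  by (simp add: bipolar_def)

lemma bipolar_zero:
  "f \<in> bipolar Z T \<Longrightarrow> cover_bounded Z D \<Longrightarrow> (\<And>t. t \<in> T \<Longrightarrow> D t = 0) \<Longrightarrow> D f = 0"
  by (simp add: bipolar_def)

lemma bipolar_add:
  "f \<in> bipolar Z T \<Longrightarrow> g \<in> bipolar Z T \<Longrightarrow> (\<lambda>z. f z + g z) \<in> bipolar Z T"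
  by (auto simp: bipolar_def cover_bounded_add)

lemma bipolar_cmult:
  "f \<in> bipolar Z T \<Longrightarrow> (\<lambda>z. c * f z) \<in> bipolar Z T"
  by (auto simp: bipolar_def cover_bounded_cmult)

lemma bipolar_diff:
  "f \<in> bipolar Z T \<Longrightarrow> g \<in> bipolar Z T \<Longrightarrow> (\<lambda>z. f z - g z) \<in> bipolar Z T"
  using bipolar_add[of f Z T "\<lambda>z. (- 1) * g z"] bipolar_cmult[of g Z T "- 1"] by simp

text \<open>
  Since \<open>D (t * _)\<close> is again such a functional, \<open>D\<close> vanishes first on products of an element of
  \<open>T\<close> with one of the bipolar, and then on products of two elements of the bipolar.
\<close>

lemma bipolar_mult:
  assumes T: "\<And>s t. s \<in> T \<Longrightarrow> t \<in> T \<Longrightarrow> (\<lambda>z. s z * t z) \<in> T"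
    and cont: "\<And>t. t \<in> T \<Longrightarrow> conv_cont Z t"
    and f: "f \<in> bipolar Z T" and g: "g \<in> bipolar Z T"
  shows "(\<lambda>z. f z * g z) \<in> bipolar Z T"
proof -
  have "D (\<lambda>z. f z * g z) = 0" if D: "cover_bounded Z D" "\<And>t. t \<in> T \<Longrightarrow> D t = 0" for D
  proof -
    have "D (\<lambda>z. t z * f z) = 0" if "t \<in> T" for t
      by (rule bipolar_zero[OF f cover_bounded_mult[OF D(1) cont[OF that]]])
        (simp add: D(2) T that)
    then have "D (\<lambda>z. f z * t z) = 0" if "t \<in> T" for t
      using that by (simp add: mult.commute[of "f _"])
    then show ?thesis
      by (intro bipolar_zero[OF g cover_bounded_mult[OF D(1) bipolar_cont[OF f]]])
  qed
  then show ?thesis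
    using bipolar_cont[OF f] bipolar_cont[OF g] by (auto simp: bipolar_def)
qed

lemma cover_bounded_norm_le:
  assumes "cover_bounded Z D"
  obtains C where "C \<ge> 0"
    "\<And>e g. e \<ge> 0 \<Longrightarrow> conv_cont Z g \<Longrightarrow> (\<And>z. norm (g z) \<le> e) \<Longrightarrow> norm (D g) \<le> C * e"
proof -
  have "cover_system Z {UNIV}"
    by (simp add: cover_system_def)
  from cover_boundedE[OF assms this] show ?thesis
    using that by metis
qed

text \<open>The case \<open>e = 0\<close> of the bound. The finite union serves as a region that
  carries \<open>D\<close>, and stands in for a finite subcover of a compact space.\<close>

lemma cover_bounded_support:
  assumes "cover_bounded Z D" "cover_system Z \<A>"
  shows "\<exists>\<K>\<subseteq>\<A>. finite \<K> \<and>
    (\<forall>g. conv_cont Z g \<longrightarrow> (\<forall>z\<in>\<Union>\<K>. g z = 0) \<longrightarrow> D g = 0)"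
proof -
  obtain K C where K: "K \<subseteq> \<A>" "finite K" "C \<ge> 0"
    "\<And>e g. e \<ge> 0 \<Longrightarrow> conv_cont Z g \<Longrightarrow> (\<And>z. z \<in> \<Union>K \<Longrightarrow> norm (g z) \<le> e) \<Longrightarrow> norm (D g) \<le> C * e"
    using cover_boundedE[OF assms] by metis
  have "D g = 0" if "conv_cont Z g" "\<forall>z\<in>\<Union>K. g z = 0" for g
    using K(4)[of 0 g] that by simp
  with K(1,2) show ?thesis
    by (intro exI[of _ K]) simp
qed

text \<open>The bipolar contains all polynomials in \<open>f\<close>, and the absolute value is a
  uniform limit of polynomials on each interval \<open>{-M..M}\<close>. As \<open>f\<close> may be
  unbounded, \<open>M\<close> is taken from finitely many sublevel sets of the absolute value of
  \<open>f\<close> on which \<open>D\<close> is controlled.\<close>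

lemma bipolar_abs:
  assumes T: "\<And>s t. s \<in> T \<Longrightarrow> t \<in> T \<Longrightarrow> (\<lambda>z. s z * t z) \<in> T"
    and cont: "\<And>t. t \<in> T \<Longrightarrow> conv_cont Z t"
    and one: "(\<lambda>z. 1) \<in> T" and f: "f \<in> bipolar Z T"
  shows "(\<lambda>z. \<bar>f z\<bar>) \<in> bipolar Z T"
proof -
  have poly: "(\<lambda>z. p (f z)) \<in> bipolar Z T" if "real_polynomial_function p" for p :: "real \<Rightarrow> real"
    using that
  proof induction
    case (linear h)
    then obtain c where "h = (\<lambda>x. x * c)"
      using real_bounded_linear by blast
    then show ?case
      using bipolar_cmult[OF f, of c] by (simp add: mult.commute)
  next
    case (const c)
    show ?case
      using bipolar_cmult[OF bipolar_superset[OF one conv_cont_const], of c] by simp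
  next
    case (add p q)
    then show ?case by (simp add: bipolar_add)
  next
    case (mult p q)
    then show ?case by (simp add: bipolar_mult T cont)
  qed
  note fc = bipolar_cont[OF f]
  have ac: "conv_cont Z (\<lambda>z. \<bar>f z\<bar>)"
    using fc by (auto simp: conv_cont_def intro: tendsto_rabs)
  have "D (\<lambda>z. \<bar>f z\<bar>) = 0" if D: "cover_bounded Z D" "\<And>t. t \<in> T \<Longrightarrow> D t = 0" for D
  proof -
    have "cover_system Z ((\<lambda>M. {z. \<bar>f z\<bar> \<le> M}) ` UNIV)"
      unfolding cover_system_def
    proof (intro allI impI)
      fix F x assume "converges Z F x"
      then have "((\<lambda>z. \<bar>f z\<bar>) \<longlongrightarrow> \<bar>f x\<bar>) F"
        using ac by (auto simp: conv_cont_def)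
      then have "eventually (\<lambda>z. \<bar>f z\<bar> < \<bar>f x\<bar> + 1) F"
        by (rule order_tendstoD) simp
      then have "eventually (\<lambda>z. z \<in> {z. \<bar>f z\<bar> \<le> \<bar>f x\<bar> + 1}) F"
        by eventually_elim simp
      then show "\<exists>A\<in>(\<lambda>M. {z. \<bar>f z\<bar> \<le> M}) ` UNIV. eventually (\<lambda>z. z \<in> A) F"
        by blast
    qed
    then obtain K C where K: "K \<subseteq> (\<lambda>M. {z. \<bar>f z\<bar> \<le> M}) ` UNIV" "finite K" "C \<ge> 0"
      "\<And>e g. e \<ge> 0 \<Longrightarrow> conv_cont Z g \<Longrightarrow> (\<And>z. z \<in> \<Union>K \<Longrightarrow> norm (g z) \<le> e) \<Longrightarrow> norm (D g) \<le> C * e"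
      using cover_boundedE[OF D(1)] by metis
    obtain J where J: "finite J" "K = (\<lambda>M. {z. \<bar>f z\<bar> \<le> M}) ` J"
      using finite_subset_image[OF K(2,1)] by blast
    define M where "M = (\<Sum>j\<in>J. \<bar>j\<bar>)"
    have M: "\<bar>f z\<bar> \<le> M" if "z \<in> \<Union>K" for z
    proof -
      obtain j where "j \<in> J" "\<bar>f z\<bar> \<le> j"
        using \<open>z \<in> \<Union>K\<close> J(2) by auto
      moreover have "\<bar>j\<bar> \<le> M"
        unfolding M_def using J(1) \<open>j \<in> J\<close> by (intro member_le_sum) auto
      ultimately show ?thesis by simp
    qed
    have "norm (D (\<lambda>z. \<bar>f z\<bar>)) \<le> 0 + e" if e: "e > 0" for e
    proof -
      \<comment> \<open>The denominator is \<open>C + 1\<close> because \<open>C\<close> may be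
        0.\<close>
      define d where "d = e / (C + 1)"
      have d: "d > 0" "C * d \<le> e"
        using e K(3) by (auto simp: d_def field_simps)
      obtain p where p: "real_polynomial_function p" "\<And>x. x \<in> {-M..M} \<Longrightarrow> \<bar>\<bar>x\<bar> - p x\<bar> < d"
        using Stone_Weierstrass_real_polynomial_function[OF compact_Icc[of "- M" M]
            continuous_on_rabs[OF continuous_on_id] d(1)] by metis
      note pf = poly[OF p(1)]
      \<comment> \<open>Subtracting the polynomial does not change the value, since \<open>D\<close>
        annihilates the bipolar; only the approximation error is left to estimate.\<close>
      have "D (\<lambda>z. \<bar>f z\<bar>) = D (\<lambda>z. \<bar>f z\<bar> - p (f z))"
        using cover_bounded_diff[OF D(1) ac bipolar_cont[OF pf]] bipolar_zero[OF pf D] by simp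
      also have "norm \<dots> \<le> C * d"
      proof (rule K(4))
        show "norm (\<bar>f z\<bar> - p (f z)) \<le> d" if "z \<in> \<Union>K" for z
        proof -
          have "f z \<in> {- M..M}"
            using M[OF that] by (auto simp: abs_le_iff)
          then show ?thesis
            using p(2) by (simp add: less_imp_le)
        qed
      qed (use d ac bipolar_cont[OF pf] in auto)
      finally show ?thesis
        using d by simp
    qed
    then show ?thesis
      using field_le_epsilon[of "norm (D (\<lambda>z. \<bar>f z\<bar>))" 0] by simp
  qed
  then show ?thesis
    using ac by (auto simp: bipolar_def)
qed

text \<open>
  A signed functional that vanishes on functions which are zero on \<open>K\<close>, and on those which are
  zero on \<open>L\<close>, need not be supported on the intersection of \<open>K\<close> and \<open>L\<close>.  Passing to the functions
  dominated by a fixed one repairs this, as they split along a sum by truncation.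
\<close>

lemma cover_bounded_vanish_sum:
  fixes D :: "('a \<Rightarrow> real) \<Rightarrow> real"
  assumes D: "cover_bounded Z D" and "finite P"
    and cont: "\<And>p. p \<in> P \<Longrightarrow> conv_cont Z (r p)" and pos: "\<And>p z. p \<in> P \<Longrightarrow> 0 \<le> r p z"
    and vanish: "\<And>p h. p \<in> P \<Longrightarrow> conv_cont Z h \<Longrightarrow> (\<And>z. \<bar>h z\<bar> \<le> r p z) \<Longrightarrow> D h = 0"
    and h: "conv_cont Z h" "\<And>z. \<bar>h z\<bar> \<le> (\<Sum>p\<in>P. r p z)"
  shows "D h = 0"
  using \<open>finite P\<close> cont pos vanish h
proof (induction P arbitrary: h)
  case empty
  then have "h = (\<lambda>z. 0 * 0)"
    by auto
  then show ?case
    using cover_bounded_cmult[OF D conv_cont_const, of 0 0] by simp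
next
  case (insert p P)
  \<comment> \<open>Truncation of \<open>h\<close> at height \<open>r p\<close>. What remains has
    absolute value \<open>max 0 (\<bar>h z\<bar> - r p z)\<close>, so it is dominated by the sum
    over the other indices and the induction hypothesis applies.\<close>
  let ?a = "\<lambda>z. max (- r p z) (min (r p z) (h z))"
  have rp: "conv_cont Z (r p)" "conv_cont Z (\<lambda>z. - r p z)"
    using insert.prems(1)[of p] conv_cont_diff[OF conv_cont_const[of Z 0], of "r p"] by auto
  have a: "conv_cont Z ?a"
    using rp insert.prems(4) by (intro conv_cont_max conv_cont_min)
  have "D ?a = 0"
    using insert.prems(2)[of p] by (intro insert.prems(3)[of p] a) (auto simp: abs_le_iff)
  moreover have "D (\<lambda>z. h z - ?a z) = 0"
  proof (rule insert.IH)
    show "\<bar>h z - ?a z\<bar> \<le> (\<Sum>p\<in>P. r p z)" for z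
      using insert.prems(2)[of p z] insert.prems(5)[of z] insert.hyps sum_nonneg[of P "\<lambda>p. r p z"] insert.prems(2)[of _ z]
      by auto
    show "D g = 0" if "q \<in> P" "conv_cont Z g" "\<And>z. \<bar>g z\<bar> \<le> r q z" for q g
      using that by (intro insert.prems(3)[of q g]) auto
    show "conv_cont Z (\<lambda>z. h z - ?a z)"
      by (rule conv_cont_diff[OF insert.prems(4) a])
  qed (use insert.prems(1,2) in auto)
  ultimately show ?case
    using cover_bounded_diff[OF D insert.prems(4) a] by simp
qed

lemma bipolar_max:
  assumes abs: "\<And>f. f \<in> bipolar Z T \<Longrightarrow> (\<lambda>z. \<bar>f z\<bar>) \<in> bipolar Z T"
    and f: "f \<in> bipolar Z T" and g: "g \<in> bipolar Z T"
  shows "(\<lambda>z. max (f z) (g z)) \<in> bipolar Z T"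
proof -
  have "(\<lambda>z. (1/2) * ((f z + g z) + \<bar>f z - g z\<bar>)) \<in> bipolar Z T"
    by (intro bipolar_cmult bipolar_add abs bipolar_diff f g)
  moreover have "(\<lambda>z. (1/2) * ((f z + g z) + \<bar>f z - g z\<bar>)) = (\<lambda>z. max (f z) (g z))"
    by (auto simp: max_def)
  ultimately show ?thesis by simp
qed

lemma bipolar_min:
  assumes abs: "\<And>f. f \<in> bipolar Z T \<Longrightarrow> (\<lambda>z. \<bar>f z\<bar>) \<in> bipolar Z T"
    and f: "f \<in> bipolar Z T" and g: "g \<in> bipolar Z T"
  shows "(\<lambda>z. min (f z) (g z)) \<in> bipolar Z T"
proof -
  have "(\<lambda>z. (1/2) * ((f z + g z) - \<bar>f z - g z\<bar>)) \<in> bipolar Z T"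
    by (intro bipolar_cmult bipolar_add abs bipolar_diff f g)
  moreover have "(\<lambda>z. (1/2) * ((f z + g z) - \<bar>f z - g z\<bar>)) = (\<lambda>z. min (f z) (g z))"
    by (auto simp: min_def)
  ultimately show ?thesis by simp
qed

lemma bipolar_Max:
  assumes abs: "\<And>f. f \<in> bipolar Z T \<Longrightarrow> (\<lambda>z. \<bar>f z\<bar>) \<in> bipolar Z T"
    and "finite Q" "Q \<noteq> {}" "\<And>q. q \<in> Q \<Longrightarrow> t q \<in> bipolar Z T"
  shows "(\<lambda>z. MAX q\<in>Q. t q z) \<in> bipolar Z T"
  using assms(2-) by (induction rule: finite_ne_induct) (simp_all add: bipolar_max[OF abs])

lemma bipolar_Min:
  assumes abs: "\<And>f. f \<in> bipolar Z T \<Longrightarrow> (\<lambda>z. \<bar>f z\<bar>) \<in> bipolar Z T"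
    and "finite Q" "Q \<noteq> {}" "\<And>q. q \<in> Q \<Longrightarrow> t q \<in> bipolar Z T"
  shows "(\<lambda>z. MIN q\<in>Q. t q z) \<in> bipolar Z T"
  using assms(2-) by (induction rule: finite_ne_induct) (simp_all add: bipolar_min[OF abs])

text \<open>The lattice form of the theorem: for fixed \<open>p\<close>, a finite maximum over
  \<open>q\<close> of interpolants lies above \<open>f - e\<close> and equals \<open>f\<close> at
  \<open>p\<close>; a finite minimum over \<open>p\<close> of these lies between
  \<open>f - e\<close> and \<open>f + e\<close>. Both inequalities hold only as far as
  \<open>D\<close> can see. So \<open>f\<close> splits into a member of the bipolar, a part bounded
  by \<open>e\<close>, and two excess parts that \<open>D\<close> annihilates.\<close>

theorem bipolar_Stone_Weierstrass:
  assumes Z: "convergence_space Z"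
    and T: "\<And>s t. s \<in> T \<Longrightarrow> t \<in> T \<Longrightarrow> (\<lambda>z. s z * t z) \<in> T"
    and cont: "\<And>t. t \<in> T \<Longrightarrow> conv_cont Z t"
    and one: "(\<lambda>z. 1) \<in> T"
    and f: "conv_cont Z f"
    and interpolate: "\<And>p q. p \<in> points Z \<Longrightarrow> q \<in> points Z \<Longrightarrow>
      \<exists>t\<in>bipolar Z T. t p = f p \<and> t q = f q"
  shows "f \<in> bipolar Z T"
proof -
  note abs = bipolar_abs[OF T cont one]
  have "D f = 0" if D: "cover_bounded Z D" "\<And>t. t \<in> T \<Longrightarrow> D t = 0" for D
  proof -
    \<comment> \<open>A filter converging to \<open>x\<close> is caught by the member indexed by
      \<open>x\<close> itself, by continuity of \<open>g x\<close> and positivity of its value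
      there.\<close>
    have ev: "cover_system Z ((\<lambda>q. {z. 0 < g q z}) ` points Z)"
      if g: "\<And>q. q \<in> points Z \<Longrightarrow> conv_cont Z (g q)" "\<And>q. q \<in> points Z \<Longrightarrow> 0 < g q q"
      for g :: "'a \<Rightarrow> 'a \<Rightarrow> real"
      unfolding cover_system_def
    proof (intro allI impI)
      fix F x assume F: "converges Z F x"
      then have x: "x \<in> points Z"
        using convergence_space.converges_proper[OF Z] by blast
      have "(g x \<longlongrightarrow> g x x) F"
        using g(1)[OF x] F by (simp add: conv_cont_def)
      then have "eventually (\<lambda>z. z \<in> {z. 0 < g x z}) F"
        using order_tendstoD(1)[OF _ g(2)[OF x]] by simp
      then show "\<exists>A\<in>(\<lambda>q. {z. 0 < g q z}) ` points Z. eventually (\<lambda>z. z \<in> A) F"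
        using x by blast
    qed
    \<comment> \<open>This constant must not depend on \<open>e\<close>, whereas the finite families
      chosen below do.\<close>
    obtain C where C: "C \<ge> 0"
      "\<And>e g. e \<ge> 0 \<Longrightarrow> conv_cont Z g \<Longrightarrow> (\<And>z. norm (g z) \<le> e) \<Longrightarrow> norm (D g) \<le> C * e"
      using cover_bounded_norm_le[OF D(1)] by metis
    have bound: "norm (D f) \<le> C * e" if e: "e > 0" for e
    proof -
      \<comment> \<open>The second conjunct expresses \<open>u \<ge> f - e\<close> from the point of
        view of \<open>D\<close>: whatever is dominated by the failure of this inequality is
        annihilated. Unlike a statement about a set depending on \<open>p\<close>, it can be
        combined over several \<open>p\<close>.\<close>
      have "\<exists>u\<in>bipolar Z T. u p = f p \<and>
          (\<forall>h. conv_cont Z h \<longrightarrow> (\<forall>z. \<bar>h z\<bar> \<le> max 0 (f z - e - u z)) \<longrightarrow> D h = 0)"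
        if p: "p \<in> points Z" for p
      proof -
        from interpolate[OF p] obtain t
          where t: "\<And>q. q \<in> points Z \<Longrightarrow> t q \<in> bipolar Z T"
            "\<And>q. q \<in> points Z \<Longrightarrow> t q p = f p" "\<And>q. q \<in> points Z \<Longrightarrow> t q q = f q"
          by metis
        have "cover_system Z ((\<lambda>q. {z. 0 < t q z - (f z - e)}) ` points Z)"
        proof (rule ev)
          show "conv_cont Z (\<lambda>z. t q z - (f z - e))" if "q \<in> points Z" for q
            by (rule conv_cont_diff[OF bipolar_cont[OF t(1)[OF that]] conv_cont_diff[OF f conv_cont_const]])
          show "0 < t q q - (f q - e)" if "q \<in> points Z" for q
            using t(3)[OF that] e by simp
        qed
        then obtain K where K: "K \<subseteq> (\<lambda>q. {z. 0 < t q z - (f z - e)}) ` points Z" "finite K"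
          "\<forall>g. conv_cont Z g \<longrightarrow> (\<forall>z\<in>\<Union>K. g z = 0) \<longrightarrow> D g = 0"
          using cover_bounded_support[OF D(1)] by meson
        obtain Q where Q: "Q \<subseteq> points Z" "finite Q" "K = (\<lambda>q. {z. 0 < t q z - (f z - e)}) ` Q"
          using finite_subset_image[OF K(2,1)] by blast
        \<comment> \<open>Inserting \<open>p\<close> makes the index set nonempty. It leaves the
          value at \<open>p\<close> intact, because all \<open>t q\<close> agree with
          \<open>f\<close> there.\<close>
        define u where "u = (\<lambda>z. MAX q\<in>insert p Q. t q z)"
        have "u \<in> bipolar Z T"
          unfolding u_def using Q p t(1) by (intro bipolar_Max abs) auto
        moreover have "u p = f p"
        proof -
          have "(\<lambda>q. t q p) ` insert p Q = {f p}"
            using Q(1) p t(2) by auto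
          then show ?thesis by (simp only: u_def Max_singleton)
        qed
        moreover have "D h = 0"
          if "conv_cont Z h" and h: "\<And>z. \<bar>h z\<bar> \<le> max 0 (f z - e - u z)" for h
        proof (rule K(3)[rule_format])
          fix z assume "z \<in> \<Union>K"
          then obtain q where "q \<in> Q" "0 < t q z - (f z - e)"
            using Q(3) by auto
          moreover have "t q z \<le> u z"
            unfolding u_def using \<open>q \<in> Q\<close> Q(2) by (intro Max_ge) auto
          ultimately show "h z = 0"
            using h[of z] by (simp add: max_def split: if_splits)
        qed fact
        ultimately show ?thesis
          by (intro bexI[of _ u]) blast+
      qed
      then obtain u where u: "\<And>p. p \<in> points Z \<Longrightarrow> u p \<in> bipolar Z T"
        "\<And>p. p \<in> points Z \<Longrightarrow> u p p = f p"
        "\<And>p h. p \<in> points Z \<Longrightarrow> conv_cont Z h \<Longrightarrow> (\<And>z. \<bar>h z\<bar> \<le> max 0 (f z - e - u p z)) \<Longrightarrow> D h = 0"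
        by metis
      have "cover_system Z ((\<lambda>p. {z. 0 < f z + e - u p z}) ` points Z)"
      proof (rule ev)
        show "conv_cont Z (\<lambda>z. f z + e - u p z)" if "p \<in> points Z" for p
          by (rule conv_cont_diff[OF conv_cont_add[OF f conv_cont_const] bipolar_cont[OF u(1)[OF that]]])
        show "0 < f p + e - u p p" if "p \<in> points Z" for p
          using u(2)[OF that] e by simp
      qed
      then obtain K where K: "K \<subseteq> (\<lambda>p. {z. 0 < f z + e - u p z}) ` points Z" "finite K"
        "\<forall>g. conv_cont Z g \<longrightarrow> (\<forall>z\<in>\<Union>K. g z = 0) \<longrightarrow> D g = 0"
        using cover_bounded_support[OF D(1)] by meson
      obtain P where P: "P \<subseteq> points Z" "finite P" "K = (\<lambda>p. {z. 0 < f z + e - u p z}) ` P"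
        using finite_subset_image[OF K(2,1)] by blast
      show ?thesis
      proof (cases "P = {}")
        \<comment> \<open>With no set at all in the finite family, \<open>D\<close> vanishes on
          every continuous function. The minimum in the other case needs a nonempty index
          set.\<close>
        case True
        then show ?thesis
          using K(3)[rule_format, OF f] P(3) C(1) e by simp
      next
        case False
        define v where "v = (\<lambda>z. MIN p\<in>P. u p z)"
        \<comment> \<open>The difference \<open>f - v\<close> is clipped to the range from
          \<open>-e\<close> to \<open>e\<close>, giving \<open>?c\<close>; the parts cut off above
          and below are \<open>?b\<close> and \<open>?a\<close>.\<close>
        let ?a = "\<lambda>z. max 0 (v z - f z - e)"
        let ?b = "\<lambda>z. max 0 (f z - e - v z)"
        let ?c = "\<lambda>z. max (- e) (min e (f z - v z))"
        have v: "v \<in> bipolar Z T"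
          unfolding v_def using P u(1) False by (intro bipolar_Min abs) auto
        note vc = bipolar_cont[OF v]
        have a: "conv_cont Z ?a" and b: "conv_cont Z ?b" and c: "conv_cont Z ?c"
          by (intro conv_cont_max conv_cont_min conv_cont_diff conv_cont_const f vc)+
        have "D ?a = 0"
        proof (rule K(3)[rule_format, OF a])
          fix z assume "z \<in> \<Union>K"
          then obtain p where p: "p \<in> P" "0 < f z + e - u p z"
            using P(3) by auto
          moreover have "v z \<le> u p z"
            unfolding v_def using p(1) P(2) by (intro Min_le) auto
          ultimately show "?a z = 0" by simp
        qed
        \<comment> \<open>At each point \<open>v\<close> coincides with one of the
          \<open>u p\<close>, so \<open>?b\<close> is dominated by the sum of their deficits
          although no single one of them dominates it everywhere.\<close>
        moreover have "D ?b = 0"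
        proof (rule cover_bounded_vanish_sum[OF D(1) P(2), where r = "\<lambda>p z. max 0 (f z - e - u p z)"])
          fix z
          have "v z \<in> (\<lambda>p. u p z) ` P"
            unfolding v_def using P(2) False by (intro Min_in) auto
          then obtain p where p: "p \<in> P" "v z = u p z"
            by auto
          have "\<bar>?b z\<bar> = max 0 (f z - e - u p z)"
            using p(2) by simp
          also have "\<dots> \<le> (\<Sum>p\<in>P. max 0 (f z - e - u p z))"
            using p(1) P(2) by (intro member_le_sum) auto
          finally show "\<bar>?b z\<bar> \<le> (\<Sum>p\<in>P. max 0 (f z - e - u p z))" .
        next
          fix p h assume "p \<in> P" "conv_cont Z h" "\<And>z. \<bar>h z\<bar> \<le> max 0 (f z - e - u p z)"
          then show "D h = 0"
            using P(1) by (intro u(3)[of p]) auto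
        next
          show "conv_cont Z (\<lambda>z. max 0 (f z - e - u p z))" if "p \<in> P" for p
            using that P(1) u(1)[of p] f bipolar_cont[of "u p" Z T]
            by (intro conv_cont_max conv_cont_diff conv_cont_const) auto
        qed (use b in auto)
        moreover have "f = (\<lambda>z. (v z + ?c z) + (?b z - ?a z))"
        proof
          show "f z = (v z + ?c z) + (?b z - ?a z)" for z
            using e by (simp add: max_def min_def)
        qed
        then have "D f = D (\<lambda>z. (v z + ?c z) + (?b z - ?a z))"
          by (rule arg_cong)
        then have "D f = (D v + D ?c) + (D ?b - D ?a)"
          by (simp only: cover_bounded_add[OF D(1) conv_cont_add[OF vc c] conv_cont_diff[OF b a]]
              cover_bounded_add[OF D(1) vc c] cover_bounded_diff[OF D(1) b a])
        moreover have "D v = 0"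
          by (rule bipolar_zero[OF v D])
        ultimately have "D f = D ?c"
          by simp
        moreover have "norm (D ?c) \<le> C * e"
          using e by (intro C(2) c) (auto simp: abs_le_iff)
        ultimately show ?thesis by simp
      qed
    qed
    have "norm (D f) \<le> 0 + e" if e: "e > 0" for e
    proof -
      have "norm (D f) \<le> C * (e / (C + 1))"
        using e C(1) by (intro bound) simp
      also have "\<dots> \<le> e"
        using e C(1) by (simp add: field_simps)
      finally show ?thesis by simp
    qed
    then show ?thesis
      using field_le_epsilon[of "norm (D f)" 0] by simp
  qed
  then show ?thesis
    using f by (auto simp: bipolar_def)
qed

subsection \<open>Continuous linear functionals\<close>

lemma converges_eventually_points:
  "convergence_space Z \<Longrightarrow> converges Z F x \<Longrightarrow> eventually (\<lambda>z. z \<in> points Z) F"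
  using convergence_space.converges_proper[of Z F x]
  by (simp add: proper_filter_on_def le_principal)

lemma converges_points: "convergence_space Z \<Longrightarrow> converges Z F x \<Longrightarrow> x \<in> points Z"
  using convergence_space.converges_proper[of Z F x] by blast

lemma converges_not_bot: "convergence_space Z \<Longrightarrow> converges Z F x \<Longrightarrow> F \<noteq> bot"
  using convergence_space.converges_proper[of Z F x] by (simp add: proper_filter_on_def)

lemma conv_cont_cong:
  assumes "convergence_space Z" "\<And>z. z \<in> points Z \<Longrightarrow> f z = g z"
  shows "conv_cont Z f \<longleftrightarrow> conv_cont Z g"
proof -
  have "(f \<longlongrightarrow> f x) F \<longleftrightarrow> (g \<longlongrightarrow> g x) F" if "converges Z F x" for F x
    using converges_eventually_points[OF assms(1) that] converges_points[OF assms(1) that] assms(2)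
    by (intro filterlim_cong refl) (auto elim: eventually_mono)
  then show ?thesis
    unfolding conv_cont_def by blast
qed

lemma scalar_maps_iff:
  assumes "convergence_space Z"
  shows "f \<in> scalar_maps Z \<longleftrightarrow> f \<in> extensional (points Z) \<and> conv_cont Z f"
  using converges_not_bot[OF assms]
  by (auto simp: continuous_maps_def conv_cont_def topological_conv_space_def filterlim_def
      filtermap_bot_iff PiE_def)

lemma restrict_scalar_maps_iff:
  assumes "convergence_space Z"
  shows "restrict f (points Z) \<in> scalar_maps Z \<longleftrightarrow> conv_cont Z f"
  using conv_cont_cong[OF assms, of "restrict f (points Z)" f]
  by (simp add: scalar_maps_iff[OF assms])

lemma converges_scalar_fun_iff:
  assumes "convergence_space Z"
  shows "converges (fun_conv_space Z topological_conv_space) \<Phi> f \<longleftrightarrow>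
    f \<in> scalar_maps Z \<and> proper_filter_on (scalar_maps Z) \<Phi> \<and>
    (\<forall>F x. converges Z F x \<longrightarrow> ((\<lambda>(g, z). g z) \<longlongrightarrow> f x) (\<Phi> \<times>\<^sub>F F))"
  using converges_not_bot[OF assms]
  by (auto simp: fun_conv_space_def topological_conv_space_def filterlim_def
      filtermap_bot_iff prod_filter_eq_bot proper_filter_on_def)

text \<open>Trades quantification over extensional maps for quantification over total functions, so
  that sums and products can be formed pointwise and restricted only at the end.\<close>

lemma continuous_linear_functional_iff:
  assumes "convergence_space Z"
  shows "continuous_linear_functional Z \<mu> \<longleftrightarrow>
    \<mu> \<in> extensional (scalar_maps Z) \<and>
    conv_cont (fun_conv_space Z topological_conv_space) \<mu> \<and>
    (\<forall>f g. conv_cont Z f \<longrightarrow> conv_cont Z g \<longrightarrow>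
        \<mu> (\<lambda>x\<in>points Z. f x + g x) = \<mu> (restrict f (points Z)) + \<mu> (restrict g (points Z))) \<and>
    (\<forall>c f. conv_cont Z f \<longrightarrow>
        \<mu> (\<lambda>x\<in>points Z. c * f x) = c * \<mu> (restrict f (points Z)))"
proof -
  have "\<mu> \<in> scalar_maps (fun_conv_space Z topological_conv_space) \<longleftrightarrow>
    \<mu> \<in> extensional (scalar_maps Z) \<and> conv_cont (fun_conv_space Z topological_conv_space) \<mu>"
    by (subst scalar_maps_iff[OF convergence_space_fun[OF assms convergence_space_topological]])
      (simp add: fun_conv_space_def)
  moreover have "(\<forall>f\<in>scalar_maps Z. \<forall>g\<in>scalar_maps Z. \<mu> (\<lambda>x\<in>points Z. f x + g x) = \<mu> f + \<mu> g) \<longleftrightarrow>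
    (\<forall>f g. conv_cont Z f \<longrightarrow> conv_cont Z g \<longrightarrow>
        \<mu> (\<lambda>x\<in>points Z. f x + g x) = \<mu> (restrict f (points Z)) + \<mu> (restrict g (points Z)))"
    (is "?l \<longleftrightarrow> ?r")
  proof
    assume l: ?l
    show ?r
    proof (intro allI impI)
      fix f g :: "'a \<Rightarrow> 'b"
      assume "conv_cont Z f" "conv_cont Z g"
      then have "\<mu> (\<lambda>x\<in>points Z. restrict f (points Z) x + restrict g (points Z) x)
          = \<mu> (restrict f (points Z)) + \<mu> (restrict g (points Z))"
        using l[rule_format, of "restrict f (points Z)" "restrict g (points Z)"]
        by (simp only: restrict_scalar_maps_iff[OF assms] simp_thms)
      then show "\<mu> (\<lambda>x\<in>points Z. f x + g x)
          = \<mu> (restrict f (points Z)) + \<mu> (restrict g (points Z))"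
        by (simp cong: restrict_cong)
    qed
  next
    assume r: ?r
    show ?l
    proof (intro ballI)
      fix f g :: "'a \<Rightarrow> 'b"
      assume "f \<in> scalar_maps Z" "g \<in> scalar_maps Z"
      then show "\<mu> (\<lambda>x\<in>points Z. f x + g x) = \<mu> f + \<mu> g"
        using r[rule_format, of f g] by (simp add: scalar_maps_iff[OF assms] extensional_restrict)
    qed
  qed
  moreover have "(\<forall>c. \<forall>f\<in>scalar_maps Z. \<mu> (\<lambda>x\<in>points Z. c * f x) = c * \<mu> f) \<longleftrightarrow>
    (\<forall>c f. conv_cont Z f \<longrightarrow>
        \<mu> (\<lambda>x\<in>points Z. c * f x) = c * \<mu> (restrict f (points Z)))"
    (is "?l \<longleftrightarrow> ?r")
  proof
    assume l: ?l
    show ?r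
    proof (intro allI impI)
      fix c and f :: "'a \<Rightarrow> 'b"
      assume "conv_cont Z f"
      then have "\<mu> (\<lambda>x\<in>points Z. c * restrict f (points Z) x) = c * \<mu> (restrict f (points Z))"
        using l[rule_format, of "restrict f (points Z)" c]
        by (simp only: restrict_scalar_maps_iff[OF assms] simp_thms)
      then show "\<mu> (\<lambda>x\<in>points Z. c * f x) = c * \<mu> (restrict f (points Z))"
        by (simp cong: restrict_cong)
    qed
  next
    assume r: ?r
    show ?l
    proof (intro allI ballI)
      fix c and f :: "'a \<Rightarrow> 'b"
      assume "f \<in> scalar_maps Z"
      then show "\<mu> (\<lambda>x\<in>points Z. c * f x) = c * \<mu> f"
        using r[rule_format, of f c] by (simp add: scalar_maps_iff[OF assms] extensional_restrict)
    qed
  qed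
  ultimately show ?thesis
    unfolding continuous_linear_functional_def by simp
qed

text \<open>The sets of functions bounded by \<open>d\<close> on a finite union of members of the
  system generate a filter. It converges continuously to 0, since every convergent filter eventually
  lies in a member. Continuity at 0 then provides one such set on which \<open>\<mu>\<close> stays
  below 1, and scaling turns this into a bound with constant \<open>1 / d\<close>.\<close>

lemma continuous_linear_functional_cover_bounded:
  fixes \<mu> :: "('a \<Rightarrow> 'k::real_normed_field) \<Rightarrow> 'k"
  assumes Z: "convergence_space Z" and \<mu>: "continuous_linear_functional Z \<mu>"
  shows "cover_bounded Z (\<lambda>g. \<mu> (restrict g (points Z)))"
proof -
  let ?r = "\<lambda>g. restrict g (points Z)"
  note lim = \<mu>[unfolded continuous_linear_functional_iff[OF Z], THEN conjunct2, THEN conjunct1]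
  have add: "\<mu> (?r (\<lambda>x. f x + g x)) = \<mu> (?r f) + \<mu> (?r g)" if "conv_cont Z f" "conv_cont Z g" for f g
    using \<mu> that by (simp add: continuous_linear_functional_iff[OF Z])
  have cmult: "\<mu> (?r (\<lambda>x. c * f x)) = c * \<mu> (?r f)" if "conv_cont Z f" for c f
    using \<mu> that by (simp add: continuous_linear_functional_iff[OF Z])
  have zero: "\<mu> (?r (\<lambda>x. 0)) = 0"
    using cmult[of "\<lambda>x. 0" 0] by auto
  have "\<exists>\<K>\<subseteq>\<A>. finite \<K> \<and> (\<exists>C\<ge>0. \<forall>e\<ge>0. \<forall>g. conv_cont Z g \<longrightarrow>
           (\<forall>z\<in>\<Union>\<K>. norm (g z) \<le> e) \<longrightarrow> norm (\<mu> (?r g)) \<le> C * e)"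
    if \<A>: "cover_system Z \<A>" for \<A>
  proof -
    define B :: "('a set set \<times> real) set" where "B = {\<K>. finite \<K> \<and> \<K> \<subseteq> \<A>} \<times> {0<..}"
    \<comment> \<open>Members of the system may reach outside \<open>points Z\<close>, where an
      extensional map takes an unspecified value; the bound is imposed only inside.\<close>
    define U where "U = (\<lambda>(\<K>, d::real). {g \<in> scalar_maps Z. \<forall>z\<in>\<Union>\<K>. z \<in> points Z \<longrightarrow> norm (g z :: 'k) \<le> d})"
    define \<Phi> where "\<Phi> = (INF b\<in>B. principal (U b))"
    have B0: "({}, 1) \<in> B"
      by (simp add: B_def)
    have ev: "eventually P \<Phi> \<longleftrightarrow> (\<exists>b\<in>B. \<forall>g\<in>U b. P g)" for P
      unfolding \<Phi>_def
    proof (subst eventually_INF_base)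
      fix a b assume "a \<in> B" "b \<in> B"
      then show "\<exists>x\<in>B. principal (U x) \<le> inf (principal (U a)) (principal (U b))"
        by (intro bexI[of _ "(fst a \<union> fst b, min (snd a) (snd b))"])
          (auto simp: B_def U_def split: prod.splits)
    qed (use B0 in \<open>auto simp: eventually_principal\<close>)
    have 0: "?r (\<lambda>x. 0) \<in> U b" if "b \<in> B" for b
      using that by (auto simp: U_def B_def restrict_scalar_maps_iff[OF Z])
    have "converges (fun_conv_space Z topological_conv_space) \<Phi> (?r (\<lambda>x. 0))"
      unfolding converges_scalar_fun_iff[OF Z]
    proof (intro conjI allI impI)
      show "?r (\<lambda>x. 0) \<in> scalar_maps Z"
        by (auto simp: restrict_scalar_maps_iff[OF Z])
      have "\<not> eventually (\<lambda>g. False) \<Phi>"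
        using 0 by (auto simp: ev)
      moreover have "eventually (\<lambda>g. g \<in> scalar_maps Z) \<Phi>"
        unfolding ev using B0 by (intro bexI[of _ "({}, 1)"]) (auto simp: U_def)
      ultimately show "proper_filter_on (scalar_maps Z) \<Phi>"
        by (auto simp: proper_filter_on_def le_principal)
      fix F x assume F: "converges Z F x"
      then obtain A where A: "A \<in> \<A>" "eventually (\<lambda>z. z \<in> A) F"
        using \<A> unfolding cover_system_def by blast
      have "((\<lambda>(g, z). g z) \<longlongrightarrow> 0) (\<Phi> \<times>\<^sub>F F)"
      proof (rule tendstoI)
        fix e :: real assume e: "e > 0"
        have "eventually (\<lambda>g. g \<in> U ({A}, e / 2)) \<Phi>"
          unfolding ev using e A(1) by (intro bexI[of _ "({A}, e / 2)"]) (auto simp: B_def)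
        moreover have "eventually (\<lambda>z. z \<in> A \<and> z \<in> points Z) F"
          using A(2) converges_eventually_points[OF Z F] by eventually_elim simp
        moreover have "dist (g z) 0 < e"
          if "g \<in> U ({A}, e / 2)" "z \<in> A \<and> z \<in> points Z" for g z
          using that e by (auto simp: U_def intro: le_less_trans[of _ "e / 2"])
        ultimately show "eventually (\<lambda>p. dist (case p of (g, z) \<Rightarrow> g z) 0 < e) (\<Phi> \<times>\<^sub>F F)"
          unfolding eventually_prod_filter
          by (intro exI[of _ "\<lambda>g. g \<in> U ({A}, e / 2)"] exI[of _ "\<lambda>z. z \<in> A \<and> z \<in> points Z"]) simp
      qed
      then show "((\<lambda>(g, z). g z) \<longlongrightarrow> ?r (\<lambda>x. 0) x) (\<Phi> \<times>\<^sub>F F)"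
        using converges_points[OF Z F] by simp
    qed
    then have "(\<mu> \<longlongrightarrow> 0) \<Phi>"
      using lim zero unfolding conv_cont_def by metis
    then have "eventually (\<lambda>g. dist (\<mu> g) 0 < 1) \<Phi>"
      by (rule tendstoD) simp
    then obtain K d where K: "finite K" "K \<subseteq> \<A>" "d > 0" "\<And>g. g \<in> U (K, d) \<Longrightarrow> norm (\<mu> g) < 1"
      unfolding ev B_def by auto
    have "norm (\<mu> (?r g)) \<le> (1 / d) * e"
      if g: "conv_cont Z g" and e: "e \<ge> 0" and le: "\<forall>z\<in>\<Union>K. norm (g z) \<le> e" for e g
    proof -
      \<comment> \<open>The scaling divides by some \<open>s > e\<close> instead of
        \<open>e\<close>, which may be 0; afterwards \<open>s\<close> tends to
        \<open>e\<close>.\<close>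
      have *: "norm (\<mu> (?r g)) \<le> s / d" if s: "s > e" for s
      proof -
        have "?r (\<lambda>z. of_real (d / s) * g z) \<in> U (K, d)"
        proof -
          have "?r (\<lambda>z. of_real (d / s) * g z) \<in> scalar_maps Z"
            unfolding restrict_scalar_maps_iff[OF Z] by (rule conv_cont_mult[OF conv_cont_const g])
          moreover have "norm (of_real (d / s) * g z) \<le> d" if "z \<in> \<Union>K" for z
          proof -
            have "norm (g z) \<le> s"
              using le s that by fastforce
            then show ?thesis
              using s e K(3) by (simp add: norm_mult norm_divide divide_simps mult_left_mono)
          qed
          ultimately show ?thesis
            unfolding U_def prod.case by (intro CollectI conjI ballI impI) (simp_all del: of_real_divide)
        qed
        then have "norm (of_real (d / s) * \<mu> (?r g)) < 1"
          using K(4) cmult[OF g] by metis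
        then show ?thesis
          using s e K(3) by (simp add: norm_mult norm_divide field_simps)
      qed
      have "norm (\<mu> (?r g)) \<le> e / d + s" if "s > 0" for s
        using *[of "e + s * d"] that K(3) by (simp add: add_divide_distrib)
      then show ?thesis
        using field_le_epsilon[of "norm (\<mu> (?r g))" "e / d"] by simp
    qed
    then show ?thesis
      using K by (intro exI[of _ K] conjI exI[of _ "1 / d"]) auto
  qed
  then show ?thesis
    unfolding cover_bounded_def by (simp add: add cmult)
qed

text \<open>Composition with \<open>\<phi>\<close> is continuous between the function spaces,
  because evaluating along \<open>F\<close> after composing is evaluating along the image filter of
  \<open>F\<close>. It is used for the swap of coordinates.\<close>

lemma continuous_linear_functional_pushforward:
  fixes W :: "'w conv_space" and Z :: "'z conv_space"
    and \<mu> :: "('w \<Rightarrow> 'k::real_normed_field) \<Rightarrow> 'k"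
  assumes W: "convergence_space W" and Z: "convergence_space Z"
    and \<phi>: "\<phi> \<in> points W \<rightarrow> points Z" "\<And>F w. converges W F w \<Longrightarrow> converges Z (filtermap \<phi> F) (\<phi> w)"
    and \<mu>: "continuous_linear_functional W \<mu>"
  shows "continuous_linear_functional Z (\<lambda>f\<in>scalar_maps Z. \<mu> (\<lambda>w\<in>points W. f (\<phi> w)))"
proof -
  note \<mu>' = \<mu>[unfolded continuous_linear_functional_iff[OF W]]
  have comp: "conv_cont W (\<lambda>w. f (\<phi> w))" if "conv_cont Z f" for f :: "'z \<Rightarrow> 'k"
    using that \<phi>(2) by (force simp: conv_cont_def filterlim_filtermap)
  have r: "(\<lambda>w\<in>points W. restrict f (points Z) (\<phi> w)) = (\<lambda>w\<in>points W. f (\<phi> w))" for f :: "'z \<Rightarrow> 'k"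
    using \<phi>(1) by (intro restrict_ext) (simp add: Pi_iff)
  have K: "(\<lambda>w\<in>points W. f (\<phi> w)) \<in> scalar_maps W" if "f \<in> scalar_maps Z" for f :: "'z \<Rightarrow> 'k"
    using that comp by (simp add: restrict_scalar_maps_iff[OF W] scalar_maps_iff[OF Z])
  let ?L = "\<lambda>f\<in>scalar_maps Z. \<mu> (\<lambda>w\<in>points W. f (\<phi> w))"
  have L: "?L (restrict f (points Z)) = \<mu> (\<lambda>w\<in>points W. f (\<phi> w))" if "conv_cont Z f" for f
    using that r[of f] restrict_scalar_maps_iff[OF Z, of f] by simp
  show ?thesis
    unfolding continuous_linear_functional_iff[OF Z]
    unfolding conv_cont_def[of "fun_conv_space Z topological_conv_space"]
  proof (intro conjI allI impI)
    fix \<Phi> and f :: "'z \<Rightarrow> 'k"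
    assume \<Phi>: "converges (fun_conv_space Z topological_conv_space) \<Phi> f"
    then have f: "f \<in> scalar_maps Z" and \<Phi>': "\<Phi> \<noteq> bot" "eventually (\<lambda>f. f \<in> scalar_maps Z) \<Phi>"
      by (auto simp: fun_conv_space_def proper_filter_on_def le_principal)
    let ?K = "\<lambda>f. \<lambda>w\<in>points W. f (\<phi> w)"
    have "converges (fun_conv_space W topological_conv_space) (filtermap ?K \<Phi>) (?K f)"
      unfolding converges_scalar_fun_iff[OF W]
    proof (intro conjI allI impI)
      show "proper_filter_on (scalar_maps W) (filtermap ?K \<Phi>)"
        using \<Phi>' K
        by (auto simp: proper_filter_on_def filtermap_bot_iff le_principal eventually_filtermap
            elim!: eventually_mono)
      fix F x assume F: "converges W F x"
      have "((\<lambda>(g, z). g z) \<longlongrightarrow> f (\<phi> x)) (\<Phi> \<times>\<^sub>F filtermap \<phi> F)"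
        using \<Phi> \<phi>(2)[OF F] by (simp add: converges_scalar_fun_iff[OF Z])
      then have "((\<lambda>(g, w). g (\<phi> w)) \<longlongrightarrow> f (\<phi> x)) (\<Phi> \<times>\<^sub>F F)"
        by (simp add: prod_filtermap2 filterlim_filtermap case_prod_unfold)
      moreover have "eventually (\<lambda>(g, w). g (\<phi> w) = ?K g w) (\<Phi> \<times>\<^sub>F F)"
        using converges_eventually_points[OF W F]
        unfolding eventually_prod_filter
        by (intro exI[of _ "\<lambda>_. True"] exI[of _ "\<lambda>w. w \<in> points W"]) auto
      ultimately have "((\<lambda>(g, w). ?K g w) \<longlongrightarrow> f (\<phi> x)) (\<Phi> \<times>\<^sub>F F)"
        by (rule Lim_transform_eventually[OF _ eventually_mono]) auto
      then show "((\<lambda>(g, z). g z) \<longlongrightarrow> ?K f x) (filtermap ?K \<Phi> \<times>\<^sub>F F)"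
        using converges_points[OF W F]
        by (simp add: prod_filtermap1 filterlim_filtermap case_prod_unfold)
    qed (rule K[OF f])
    then have "(\<mu> \<longlongrightarrow> \<mu> (?K f)) (filtermap ?K \<Phi>)"
      using \<mu>' unfolding conv_cont_def[of "fun_conv_space W topological_conv_space"] by blast
    then have "((\<lambda>f. \<mu> (?K f)) \<longlongrightarrow> \<mu> (?K f)) \<Phi>"
      by (simp only: filterlim_filtermap)
    moreover have "eventually (\<lambda>f. \<mu> (?K f) = ?L f) \<Phi>"
      using \<Phi>'(2) by (rule eventually_mono) simp
    ultimately have "(?L \<longlongrightarrow> \<mu> (?K f)) \<Phi>"
      by (rule Lim_transform_eventually)
    then show "(?L \<longlongrightarrow> ?L f) \<Phi>"
      using f by simp
  next
    fix f g :: "'z \<Rightarrow> 'k"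
    assume f: "conv_cont Z f" and g: "conv_cont Z g"
    have "\<mu> (\<lambda>w\<in>points W. f (\<phi> w) + g (\<phi> w))
        = \<mu> (\<lambda>w\<in>points W. f (\<phi> w)) + \<mu> (\<lambda>w\<in>points W. g (\<phi> w))"
      using \<mu>' comp[OF f] comp[OF g] by blast
    then show "?L (\<lambda>x\<in>points Z. f x + g x) = ?L (restrict f (points Z)) + ?L (restrict g (points Z))"
      by (simp only: L[OF f] L[OF g] L[OF conv_cont_add[OF f g]])
  next
    fix c and f :: "'z \<Rightarrow> 'k"
    assume f: "conv_cont Z f"
    have "\<mu> (\<lambda>w\<in>points W. c * f (\<phi> w)) = c * \<mu> (\<lambda>w\<in>points W. f (\<phi> w))"
      using \<mu>' comp[OF f] by blast
    then show "?L (\<lambda>x\<in>points Z. c * f x) = c * ?L (restrict f (points Z))"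
      by (simp only: L[OF f] L[OF conv_cont_mult[OF conv_cont_const f]])
  qed (rule restrict_extensional)
qed

subsection \<open>Iterated integrals\<close>

lemma conv_cont_section_fst:
  assumes X: "convergence_space X" and Y: "convergence_space Y"
    and f: "conv_cont (prod_conv_space X Y) f" and y: "y \<in> points Y"
  shows "conv_cont X (\<lambda>x. f (x, y))"
  unfolding conv_cont_def
proof (intro allI impI)
  fix F x assume "converges X F x"
  then have "(f \<longlongrightarrow> f (x, y)) (F \<times>\<^sub>F principal {y})"
    using f prod_filter_converges[OF X Y _ convergence_space.converges_point[OF Y y]]
    unfolding conv_cont_def by blast
  then show "((\<lambda>x. f (x, y)) \<longlongrightarrow> f (x, y)) F"
    by (simp add: prod_filter_principal_singleton2 filterlim_filtermap)
qed

lemma conv_cont_section_snd: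
  assumes X: "convergence_space X" and Y: "convergence_space Y"
    and f: "conv_cont (prod_conv_space X Y) f" and x: "x \<in> points X"
  shows "conv_cont Y (\<lambda>y. f (x, y))"
  unfolding conv_cont_def
proof (intro allI impI)
  fix F y assume "converges Y F y"
  then have "(f \<longlongrightarrow> f (x, y)) (principal {x} \<times>\<^sub>F F)"
    using f prod_filter_converges[OF X Y convergence_space.converges_point[OF X x]]
    unfolding conv_cont_def by blast
  then show "((\<lambda>y. f (x, y)) \<longlongrightarrow> f (x, y)) F"
    by (simp add: prod_filter_principal_singleton filterlim_filtermap)
qed

lemma conv_cont_fst:
  assumes "conv_cont X g"
  shows "conv_cont (prod_conv_space X Y) (\<lambda>p. g (fst p))"
  unfolding conv_cont_def
proof (intro allI impI)
  fix F p assume "converges (prod_conv_space X Y) F p"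
  then have "(g \<longlongrightarrow> g (fst p)) (filtermap fst F)"
    using assms by (simp add: conv_cont_def prod_conv_space_def)
  then show "((\<lambda>p. g (fst p)) \<longlongrightarrow> g (fst p)) F"
    by (simp only: filterlim_filtermap)
qed

lemma conv_cont_snd:
  assumes "conv_cont Y g"
  shows "conv_cont (prod_conv_space X Y) (\<lambda>p. g (snd p))"
  unfolding conv_cont_def
proof (intro allI impI)
  fix F p assume "converges (prod_conv_space X Y) F p"
  then have "(g \<longlongrightarrow> g (snd p)) (filtermap snd F)"
    using assms by (simp add: conv_cont_def prod_conv_space_def)
  then show "((\<lambda>p. g (snd p)) \<longlongrightarrow> g (snd p)) F"
    by (simp only: filterlim_filtermap)
qed

text \<open>The functional is \<open>\<nu>\<close> after the map that sends \<open>f\<close> to its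
  partial integral. That map is continuous into the functions on \<open>Y\<close> by the exponential
  law for continuous convergence.\<close>

lemma continuous_linear_functional_iterated:
  fixes X :: "'x conv_space" and Y :: "'y conv_space"
    and \<mu> :: "('x \<Rightarrow> 'k::real_normed_field) \<Rightarrow> 'k"
  assumes X: "convergence_space X" and Y: "convergence_space Y"
    and \<mu>: "continuous_linear_functional X \<mu>" and \<nu>: "continuous_linear_functional Y \<nu>"
  shows "continuous_linear_functional (prod_conv_space X Y)
    (\<lambda>f\<in>scalar_maps (prod_conv_space X Y). \<nu> (\<lambda>y\<in>points Y. \<mu> (\<lambda>x\<in>points X. f (x, y))))"
proof -
  let ?P = "prod_conv_space X Y"
  let ?S = "\<lambda>f y. \<lambda>x\<in>points X. f (x, y)"
  let ?K = "\<lambda>f. \<lambda>y\<in>points Y. \<mu> (?S f y)"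
  let ?L = "\<lambda>f\<in>scalar_maps ?P. \<nu> (?K f)"
  note P = convergence_space_prod[OF X Y]
  note \<mu>' = \<mu>[unfolded continuous_linear_functional_iff[OF X]]
  note \<nu>' = \<nu>[unfolded continuous_linear_functional_iff[OF Y]]
  have S: "?S f y \<in> scalar_maps X" if "f \<in> scalar_maps ?P" "y \<in> points Y" for f :: "'x \<times> 'y \<Rightarrow> 'k" and y
    using continuous_maps_section[OF X Y that] .
  have K: "?K f \<in> scalar_maps Y" if "f \<in> scalar_maps ?P" for f :: "'x \<times> 'y \<Rightarrow> 'k"
    using continuous_maps_partial_integral[OF X Y that \<mu>] .
  have r: "?K (restrict f (points ?P)) = ?K f" for f :: "'x \<times> 'y \<Rightarrow> 'k"
    by (intro restrict_ext arg_cong[of _ _ \<mu>]) (simp add: prod_conv_space_def)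
  have rS: "restrict f (points ?P) \<in> scalar_maps ?P" if "conv_cont ?P f" for f :: "'x \<times> 'y \<Rightarrow> 'k"
    using that by (simp only: restrict_scalar_maps_iff[OF P])
  have L: "?L (restrict f (points ?P)) = \<nu> (?K f)" if "conv_cont ?P f" for f
    using r[of f] rS[OF that] by simp
  have KC: "conv_cont Y (\<lambda>y. \<mu> (?S f y))" if "conv_cont ?P f" for f :: "'x \<times> 'y \<Rightarrow> 'k"
    using K[OF rS[OF that]] unfolding r restrict_scalar_maps_iff[OF Y] .
  note SC = conv_cont_section_fst[OF X Y]
  show ?thesis
    unfolding continuous_linear_functional_iff[OF P]
    unfolding conv_cont_def[of "fun_conv_space ?P topological_conv_space"]
  proof (intro conjI allI impI)
    fix \<Phi> and f :: "'x \<times> 'y \<Rightarrow> 'k"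
    assume \<Phi>: "converges (fun_conv_space ?P topological_conv_space) \<Phi> f"
    then have f: "f \<in> scalar_maps ?P" and \<Phi>': "\<Phi> \<noteq> bot" "eventually (\<lambda>f. f \<in> scalar_maps ?P) \<Phi>"
      by (auto simp: fun_conv_space_def proper_filter_on_def le_principal)
    have "converges (fun_conv_space Y topological_conv_space) (filtermap ?K \<Phi>) (?K f)"
      unfolding converges_scalar_fun_iff[OF Y]
    proof (intro conjI allI impI)
      show "?K f \<in> scalar_maps Y"
        by (rule K[OF f])
      have "eventually (\<lambda>f. ?K f \<in> scalar_maps Y) \<Phi>"
        using \<Phi>'(2) by (rule eventually_mono) (rule K)
      then show "proper_filter_on (scalar_maps Y) (filtermap ?K \<Phi>)"
        using \<Phi>'(1)
        by (simp add: proper_filter_on_def filtermap_bot_iff le_principal eventually_filtermap)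
      fix G y assume G: "converges Y G y"
      note y = converges_points[OF Y G] and Gp = converges_eventually_points[OF Y G]
      \<comment> \<open>Continuous convergence of the partial integrals lets \<open>f\<close> and
        \<open>y\<close> vary together, so the sections have to converge along the product of both
        filters.\<close>
      let ?\<Theta> = "filtermap (\<lambda>p. ?S (fst p) (snd p)) (\<Phi> \<times>\<^sub>F G)"
      have "converges (fun_conv_space X topological_conv_space) ?\<Theta> (?S f y)"
        unfolding converges_scalar_fun_iff[OF X]
      proof (intro conjI allI impI)
        show "?S f y \<in> scalar_maps X"
          by (rule S[OF f y])
        have "eventually (\<lambda>p. ?S (fst p) (snd p) \<in> scalar_maps X) (\<Phi> \<times>\<^sub>F G)"
          unfolding eventually_prod_filter
          by (intro exI[of _ "\<lambda>f. f \<in> scalar_maps ?P"] exI[of _ "\<lambda>y. y \<in> points Y"])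
            (use \<Phi>'(2) Gp S in auto)
        then show "proper_filter_on (scalar_maps X) ?\<Theta>"
          using \<Phi>'(1) converges_not_bot[OF Y G]
          by (simp add: proper_filter_on_def filtermap_bot_iff le_principal eventually_filtermap
              prod_filter_eq_bot)
        fix F x assume F: "converges X F x"
        note x = converges_points[OF X F] and Fp = converges_eventually_points[OF X F]
        let ?Q = "(\<Phi> \<times>\<^sub>F G) \<times>\<^sub>F F"
        have fst': "filterlim fst (\<Phi> \<times>\<^sub>F G) ?Q" and snd': "filterlim snd F ?Q"
          by (simp_all add: filterlim_def filtermap_fst_prod_filter filtermap_snd_prod_filter)
        have "filterlim fst \<Phi> (\<Phi> \<times>\<^sub>F G)" "filterlim snd G (\<Phi> \<times>\<^sub>F G)"
          by (simp_all add: filterlim_def filtermap_fst_prod_filter filtermap_snd_prod_filter)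
        \<comment> \<open>Reassociation of the three filters: the convergence of
          \<open>\<Phi>\<close> can only be tested against a filter on the product space.\<close>
        then have lim: "filterlim (\<lambda>q. (fst (fst q), (snd q, snd (fst q)))) (\<Phi> \<times>\<^sub>F (F \<times>\<^sub>F G)) ?Q"
          by (intro filterlim_Pair snd' filterlim_compose[OF _ fst'])
        have "((\<lambda>(g, z). g z) \<longlongrightarrow> f (x, y)) (\<Phi> \<times>\<^sub>F (F \<times>\<^sub>F G))"
          using \<Phi> prod_filter_converges[OF X Y F G] by (simp add: converges_scalar_fun_iff[OF P])
        from filterlim_compose[OF this lim]
        have "((\<lambda>q. fst (fst q) (snd q, snd (fst q))) \<longlongrightarrow> f (x, y)) ?Q"
          by (simp only: prod.case)
        moreover have "eventually (\<lambda>q. fst (fst q) (snd q, snd (fst q))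
            = ?S (fst (fst q)) (snd (fst q)) (snd q)) ?Q"
          unfolding eventually_prod_filter[of _ _ F]
          by (intro exI[of _ "\<lambda>_. True"] exI[of _ "\<lambda>x. x \<in> points X"]) (simp add: Fp)
        ultimately have "((\<lambda>q. ?S (fst (fst q)) (snd (fst q)) (snd q)) \<longlongrightarrow> f (x, y)) ?Q"
          by (rule Lim_transform_eventually)
        then show "((\<lambda>(g, z). g z) \<longlongrightarrow> ?S f y x) (?\<Theta> \<times>\<^sub>F F)"
          using x by (simp add: prod_filtermap1 filterlim_filtermap case_prod_unfold)
      qed
      then have "(\<mu> \<longlongrightarrow> \<mu> (?S f y)) ?\<Theta>"
        using \<mu>' unfolding conv_cont_def[of "fun_conv_space X topological_conv_space"] by blast
      then have "((\<lambda>p. \<mu> (?S (fst p) (snd p))) \<longlongrightarrow> \<mu> (?S f y)) (\<Phi> \<times>\<^sub>F G)"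
        by (simp only: filterlim_filtermap)
      moreover have "eventually (\<lambda>p. \<mu> (?S (fst p) (snd p)) = ?K (fst p) (snd p)) (\<Phi> \<times>\<^sub>F G)"
        unfolding eventually_prod_filter
        by (intro exI[of _ "\<lambda>_. True"] exI[of _ "\<lambda>y. y \<in> points Y"]) (simp add: Gp)
      ultimately have "((\<lambda>p. ?K (fst p) (snd p)) \<longlongrightarrow> \<mu> (?S f y)) (\<Phi> \<times>\<^sub>F G)"
        by (rule Lim_transform_eventually)
      then show "((\<lambda>(g, z). g z) \<longlongrightarrow> ?K f y) (filtermap ?K \<Phi> \<times>\<^sub>F G)"
        using y by (simp add: prod_filtermap1 filterlim_filtermap case_prod_unfold)
    qed
    then have "(\<nu> \<longlongrightarrow> \<nu> (?K f)) (filtermap ?K \<Phi>)"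
      using \<nu>' unfolding conv_cont_def[of "fun_conv_space Y topological_conv_space"] by blast
    then have "((\<lambda>f. \<nu> (?K f)) \<longlongrightarrow> \<nu> (?K f)) \<Phi>"
      by (simp only: filterlim_filtermap)
    moreover have "eventually (\<lambda>f. \<nu> (?K f) = ?L f) \<Phi>"
      using \<Phi>'(2) by (rule eventually_mono) simp
    ultimately have "(?L \<longlongrightarrow> \<nu> (?K f)) \<Phi>"
      by (rule Lim_transform_eventually)
    then show "(?L \<longlongrightarrow> ?L f) \<Phi>"
      using f by simp
  next
    fix f g :: "'x \<times> 'y \<Rightarrow> 'k"
    assume f: "conv_cont ?P f" and g: "conv_cont ?P g"
    have "\<mu> (?S (\<lambda>p. f p + g p) y) = \<mu> (?S f y) + \<mu> (?S g y)" if "y \<in> points Y" for y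
      using \<mu>' SC[OF f that] SC[OF g that] by blast
    then have "?K (\<lambda>p. f p + g p) = (\<lambda>y\<in>points Y. \<mu> (?S f y) + \<mu> (?S g y))"
      by (intro restrict_ext)
    moreover have "\<nu> (\<lambda>y\<in>points Y. \<mu> (?S f y) + \<mu> (?S g y)) = \<nu> (?K f) + \<nu> (?K g)"
      using \<nu>' KC[OF f] KC[OF g] by blast
    ultimately show "?L (\<lambda>p\<in>points ?P. f p + g p) = ?L (restrict f (points ?P)) + ?L (restrict g (points ?P))"
      by (simp only: L[OF f] L[OF g] L[OF conv_cont_add[OF f g]])
  next
    fix c and f :: "'x \<times> 'y \<Rightarrow> 'k"
    assume f: "conv_cont ?P f"
    have "\<mu> (?S (\<lambda>p. c * f p) y) = c * \<mu> (?S f y)" if "y \<in> points Y" for y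
      using \<mu>' SC[OF f that] by blast
    then have "?K (\<lambda>p. c * f p) = (\<lambda>y\<in>points Y. c * \<mu> (?S f y))"
      by (intro restrict_ext)
    moreover have "\<nu> (\<lambda>y\<in>points Y. c * \<mu> (?S f y)) = c * \<nu> (?K f)"
      using \<nu>' KC[OF f] by blast
    ultimately show "?L (\<lambda>p\<in>points ?P. c * f p) = c * ?L (restrict f (points ?P))"
      by (simp only: L[OF f] L[OF conv_cont_mult[OF conv_cont_const f]])
  qed (rule restrict_extensional)
qed

text \<open>The same result with the roles of \<open>X\<close> and \<open>Y\<close> exchanged,
  pushed forward along the swap of coordinates.\<close>

lemma continuous_linear_functional_iterated':
  fixes X :: "'x conv_space" and Y :: "'y conv_space"
    and \<mu> :: "('x \<Rightarrow> 'k::real_normed_field) \<Rightarrow> 'k"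
  assumes X: "convergence_space X" and Y: "convergence_space Y"
    and \<mu>: "continuous_linear_functional X \<mu>" and \<nu>: "continuous_linear_functional Y \<nu>"
  shows "continuous_linear_functional (prod_conv_space X Y)
    (\<lambda>f\<in>scalar_maps (prod_conv_space X Y). \<mu> (\<lambda>x\<in>points X. \<nu> (\<lambda>y\<in>points Y. f (x, y))))"
proof -
  let ?P = "prod_conv_space X Y" and ?P' = "prod_conv_space Y X"
  let ?s = "\<lambda>p :: 'y \<times> 'x. (snd p, fst p)"
  let ?J = "\<lambda>f\<in>scalar_maps ?P'. \<mu> (\<lambda>x\<in>points X. \<nu> (\<lambda>y\<in>points Y. f (y, x)))"
  note P = convergence_space_prod[OF X Y] and P' = convergence_space_prod[OF Y X]
  have swap: "converges ?P (filtermap ?s F) (?s p)" if "converges ?P' F p" for F p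
    using that
    by (auto simp: prod_conv_space_def proper_filter_on_def filtermap_filtermap filtermap_bot_iff
        le_principal eventually_filtermap mem_Times_iff elim!: eventually_mono)
  have "continuous_linear_functional ?P (\<lambda>f\<in>scalar_maps ?P. ?J (\<lambda>p\<in>points ?P'. f (?s p)))"
  proof (rule continuous_linear_functional_pushforward[OF P' P _ swap])
    show "?s \<in> points ?P' \<rightarrow> points ?P"
      by (auto simp: prod_conv_space_def)
    show "continuous_linear_functional ?P' ?J"
      by (rule continuous_linear_functional_iterated[OF Y X \<nu> \<mu>])
  qed
  moreover have "?J (\<lambda>p\<in>points ?P'. f (?s p)) = \<mu> (\<lambda>x\<in>points X. \<nu> (\<lambda>y\<in>points Y. f (x, y)))"
    if f: "f \<in> scalar_maps ?P" for f :: "'x \<times> 'y \<Rightarrow> 'k"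
  proof -
    have "conv_cont ?P' (\<lambda>p. f (?s p))"
      unfolding conv_cont_def
    proof (intro allI impI)
      fix F p assume "converges ?P' F p"
      then have "(f \<longlongrightarrow> f (?s p)) (filtermap ?s F)"
        using swap f unfolding scalar_maps_iff[OF P] conv_cont_def by blast
      then show "((\<lambda>p. f (?s p)) \<longlongrightarrow> f (?s p)) F"
        by (simp only: filterlim_filtermap)
    qed
    then have "(\<lambda>p\<in>points ?P'. f (?s p)) \<in> scalar_maps ?P'"
      by (simp only: restrict_scalar_maps_iff[OF P'])
    moreover have "(\<lambda>x\<in>points X. \<nu> (\<lambda>y\<in>points Y. (\<lambda>p\<in>points ?P'. f (?s p)) (y, x)))
        = (\<lambda>x\<in>points X. \<nu> (\<lambda>y\<in>points Y. f (x, y)))"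
      by (intro restrict_ext arg_cong[of _ _ \<nu>]) (simp add: prod_conv_space_def)
    ultimately show ?thesis
      by (simp only: restrict_apply if_True)
  qed
  then have "(\<lambda>f\<in>scalar_maps ?P. ?J (\<lambda>p\<in>points ?P'. f (?s p)))
      = (\<lambda>f\<in>scalar_maps ?P. \<mu> (\<lambda>x\<in>points X. \<nu> (\<lambda>y\<in>points Y. f (x, y))))"
    by (rule restrict_ext)
  ultimately show ?thesis
    by (simp only:)
qed

section \<open>Functionals vanishing on tensors\<close>

text \<open>Tensors are closed under products but not under sums; the bipolar supplies the sums. The
  interpolant is a combination of three tensors and covers coinciding points or coordinates without
  a case distinction.\<close>

lemma cover_bounded_zero_of_tensors_real:
  fixes D :: "('x \<times> 'y \<Rightarrow> real) \<Rightarrow> real"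
  assumes X: "convergence_space X" and Y: "convergence_space Y"
    and D: "cover_bounded (prod_conv_space X Y) D"
    and tensor: "\<And>g h. conv_cont X g \<Longrightarrow> conv_cont Y h \<Longrightarrow> D (\<lambda>p. g (fst p) * h (snd p)) = 0"
    and f: "conv_cont (prod_conv_space X Y) f"
  shows "D f = 0"
proof -
  let ?P = "prod_conv_space X Y"
  define T :: "('x \<times> 'y \<Rightarrow> real) set"
    where "T = {\<lambda>p. g (fst p) * h (snd p) | g h. conv_cont X g \<and> conv_cont Y h}"
  have TI: "(\<lambda>p. g (fst p) * h (snd p)) \<in> T" if "conv_cont X g" "conv_cont Y h" for g h
    using that unfolding T_def by blast
  have Tc: "conv_cont ?P t" if "t \<in> T" for t
    using that unfolding T_def by (auto intro!: conv_cont_mult conv_cont_fst conv_cont_snd)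
  have "f \<in> bipolar ?P T"
  proof (rule bipolar_Stone_Weierstrass[OF convergence_space_prod[OF X Y]])
    fix s t assume "s \<in> T" "t \<in> T"
    then obtain g h g' h' where
      s: "s = (\<lambda>p. g (fst p) * h (snd p))" "conv_cont X g" "conv_cont Y h" and
      t: "t = (\<lambda>p. g' (fst p) * h' (snd p))" "conv_cont X g'" "conv_cont Y h'"
      unfolding T_def by blast
    have "(\<lambda>p. (g (fst p) * g' (fst p)) * (h (snd p) * h' (snd p))) \<in> T"
      using TI[OF conv_cont_mult[OF s(2) t(2)] conv_cont_mult[OF s(3) t(3)]] .
    then show "(\<lambda>z. s z * t z) \<in> T"
      by (simp add: s(1) t(1) mult_ac)
  next
    show "(\<lambda>z. 1) \<in> T"
      using TI[OF conv_cont_const conv_cont_const, of 1 1] by simp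
  next
    fix p q assume "p \<in> points ?P" "q \<in> points ?P"
    then have p: "snd p \<in> points Y" and q: "fst q \<in> points X"
      by (auto simp: prod_conv_space_def)
    txt \<open>Adding the two sections of \<open>f\<close> and subtracting the corner value interpolates \<open>f\<close> at both points.\<close>
    have "(\<lambda>z. f (fst z, snd p)) \<in> T"
      using TI[OF conv_cont_section_fst[OF X Y f p] conv_cont_const[of Y 1]] by simp
    moreover have "(\<lambda>z. f (fst q, snd z)) \<in> T"
      using TI[OF conv_cont_const[of X 1] conv_cont_section_snd[OF X Y f q]] by simp
    moreover have "(\<lambda>z. f (fst q, snd p)) \<in> T"
      using TI[OF conv_cont_const[of X "f (fst q, snd p)"] conv_cont_const[of Y 1]] by simp
    ultimately have "(\<lambda>z. (f (fst z, snd p) + f (fst q, snd z)) - f (fst q, snd p)) \<in> bipolar ?P T"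
      by (intro bipolar_diff bipolar_add bipolar_superset Tc)
    then show "\<exists>t\<in>bipolar ?P T. t p = f p \<and> t q = f q"
      by (rule bexI[rotated]) simp
  qed (use Tc f in auto)
  moreover have "D t = 0" if t: "t \<in> T" for t
  proof -
    obtain g h where "t = (\<lambda>p. g (fst p) * h (snd p))" "conv_cont X g" "conv_cont Y h"
      using t unfolding T_def by blast
    then show ?thesis
      using tensor by simp
  qed
  ultimately show ?thesis
    using D by (simp add: bipolar_zero)
qed

lemma cover_bounded_real_part:
  fixes D :: "('a \<Rightarrow> 'k::real_normed_field) \<Rightarrow> 'k"
  assumes D: "cover_bounded Z D" and \<phi>: "bounded_linear \<phi>"
  shows "cover_bounded Z (\<lambda>g. \<phi> (D (\<lambda>z. of_real (g z))) :: real)"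
proof -
  interpret \<phi>: bounded_linear \<phi> by fact
  have c: "conv_cont Z (\<lambda>z. of_real (g z) :: 'k)" if "conv_cont Z g" for g
    using that by (auto simp: conv_cont_def intro: tendsto_of_real)
  have "\<exists>\<K>\<subseteq>\<A>. finite \<K> \<and> (\<exists>C\<ge>0. \<forall>e\<ge>0. \<forall>g. conv_cont Z g \<longrightarrow>
      (\<forall>z\<in>\<Union>\<K>. norm (g z) \<le> e) \<longrightarrow> norm (\<phi> (D (\<lambda>z. of_real (g z)))) \<le> C * e)"
    if \<A>: "cover_system Z \<A>" for \<A>
  proof -
    obtain K C where K: "K \<subseteq> \<A>" "finite K" "C \<ge> 0"
      "\<And>e g. e \<ge> 0 \<Longrightarrow> conv_cont Z g \<Longrightarrow> (\<And>z. z \<in> \<Union>K \<Longrightarrow> norm (g z) \<le> e) \<Longrightarrow> norm (D g) \<le> C * e"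
      using cover_boundedE[OF D \<A>] by metis
    obtain B where B: "B \<ge> 0" "\<And>x. norm (\<phi> x) \<le> norm x * B"
      using \<phi>.nonneg_bounded by blast
    have "norm (\<phi> (D (\<lambda>z. of_real (g z)))) \<le> (C * B) * e"
      if "e \<ge> 0" "conv_cont Z g" "\<forall>z\<in>\<Union>K. norm (g z) \<le> e" for e g
    proof -
      have "norm (D (\<lambda>z. of_real (g z))) \<le> C * e"
        using that by (intro K(4) c) auto
      then have "norm (D (\<lambda>z. of_real (g z))) * B \<le> C * e * B"
        using B(1) by (rule mult_right_mono)
      then show ?thesis
        using B(2)[of "D (\<lambda>z. of_real (g z))"] by (simp add: mult_ac)
    qed
    then show ?thesis
      using K B(1) by (intro exI[of _ K] conjI exI[of _ "C * B"]) auto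
  qed
  moreover have "\<phi> (D (\<lambda>z. of_real (f z + g z))) = \<phi> (D (\<lambda>z. of_real (f z))) + \<phi> (D (\<lambda>z. of_real (g z)))"
    if "conv_cont Z f" "conv_cont Z g" for f g
    using cover_bounded_add[OF D c[OF that(1)] c[OF that(2)]] by (simp add: \<phi>.add)
  moreover have "\<phi> (D (\<lambda>z. of_real (a * f z))) = a * \<phi> (D (\<lambda>z. of_real (f z)))"
    if "conv_cont Z f" for a f
  proof -
    \<comment> \<open>Since \<open>\<phi>\<close> is only real-linear, the scalar is rewritten as
      \<open>*\<^sub>R\<close> before it is pulled out.\<close>
    have "D (\<lambda>z. of_real a * of_real (f z)) = a *\<^sub>R D (\<lambda>z. of_real (f z))"
      using cover_bounded_cmult[OF D c[OF that], of "of_real a"] by (simp add: scaleR_conv_of_real)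
    then show ?thesis
      by (simp add: \<phi>.scaleR)
  qed
  ultimately show ?thesis
    unfolding cover_bounded_def by simp
qed

text \<open>A real tensor is also a complex one, so the real and imaginary parts of \<open>D\<close>
  annihilate real tensors, and hence all real continuous functions. Complex linearity of
  \<open>D\<close> then covers the real and imaginary parts of \<open>f\<close>.\<close>

lemma cover_bounded_zero_of_tensors_complex:
  fixes D :: "('x \<times> 'y \<Rightarrow> complex) \<Rightarrow> complex"
  assumes X: "convergence_space X" and Y: "convergence_space Y"
    and D: "cover_bounded (prod_conv_space X Y) D"
    and tensor: "\<And>g h. conv_cont X g \<Longrightarrow> conv_cont Y h \<Longrightarrow> D (\<lambda>p. g (fst p) * h (snd p)) = 0"
    and f: "conv_cont (prod_conv_space X Y) f"
  shows "D f = 0"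
proof -
  let ?P = "prod_conv_space X Y"
  have c: "conv_cont Z (\<lambda>z. complex_of_real (g z))" if "conv_cont Z g" for Z :: "'z conv_space" and g
    using that by (auto simp: conv_cont_def intro: tendsto_of_real)
  have zero: "D (\<lambda>p. complex_of_real (u p)) = 0" if u: "conv_cont ?P u" for u
  proof -
    have "\<phi> (D (\<lambda>p. complex_of_real (u p))) = 0" if \<phi>: "bounded_linear \<phi>" for \<phi> :: "complex \<Rightarrow> real"
    proof (rule cover_bounded_zero_of_tensors_real[OF X Y cover_bounded_real_part[OF D \<phi>] _ u])
      fix g :: "'x \<Rightarrow> real" and h :: "'y \<Rightarrow> real"
      assume "conv_cont X g" "conv_cont Y h"
      then have "D (\<lambda>p. complex_of_real (g (fst p) * h (snd p))) = 0"
        using tensor[OF c[of X g] c[of Y h]] by simp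
      then show "\<phi> (D (\<lambda>p. complex_of_real (g (fst p) * h (snd p)))) = 0"
        using linear_0[OF bounded_linear.linear[OF \<phi>]] by simp
    qed
    from this[OF bounded_linear_Re] this[OF bounded_linear_Im] show ?thesis
      by (simp add: complex_eq_iff)
  qed
  have Re: "conv_cont ?P (\<lambda>p. Re (f p))" and Im: "conv_cont ?P (\<lambda>p. Im (f p))"
    using f by (auto simp: conv_cont_def intro: tendsto_Re tendsto_Im)
  have "f = (\<lambda>p. complex_of_real (Re (f p)) + \<i> * complex_of_real (Im (f p)))"
    using complex_eq by auto
  then have "D f = D (\<lambda>p. complex_of_real (Re (f p)) + \<i> * complex_of_real (Im (f p)))"
    by (rule arg_cong)
  also have "\<dots> = D (\<lambda>p. complex_of_real (Re (f p))) + \<i> * D (\<lambda>p. complex_of_real (Im (f p)))"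
    by (simp only: cover_bounded_add[OF D c[OF Re] conv_cont_mult[OF conv_cont_const c[OF Im]]]
        cover_bounded_cmult[OF D c[OF Im]])
  finally show ?thesis
    by (simp add: zero Re Im)
qed

section \<open>Existence and uniqueness of the tensor product\<close>

text \<open>The density of tensors enters as the hypothesis \<open>dense\<close>, since its proof
  differs for real and complex scalars while the rest works over any real normed field.\<close>

lemma ex1_tensor_functional:
  fixes X :: "'x conv_space" and Y :: "'y conv_space"
    and \<mu> :: "('x \<Rightarrow> 'k::real_normed_field) \<Rightarrow> 'k"
  assumes X: "convergence_space X" and Y: "convergence_space Y"
    and dense: "\<And>(D :: ('x \<times> 'y \<Rightarrow> 'k) \<Rightarrow> 'k) f. cover_bounded (prod_conv_space X Y) D \<Longrightarrow>
      (\<And>g h. conv_cont X g \<Longrightarrow> conv_cont Y h \<Longrightarrow> D (\<lambda>p. g (fst p) * h (snd p)) = 0) \<Longrightarrow>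
      conv_cont (prod_conv_space X Y) f \<Longrightarrow> D f = 0"
    and \<mu>: "continuous_linear_functional X \<mu>" and \<nu>: "continuous_linear_functional Y \<nu>"
  shows "\<exists>!\<pi>. continuous_linear_functional (prod_conv_space X Y) \<pi> \<and>
     (\<forall>f \<in> scalar_maps (prod_conv_space X Y).
        \<nu> (\<lambda>y\<in>points Y. \<mu> (\<lambda>x\<in>points X. f (x, y))) = \<pi> f \<and>
        \<pi> f = \<mu> (\<lambda>x\<in>points X. \<nu> (\<lambda>y\<in>points Y. f (x, y))))"
proof -
  let ?P = "prod_conv_space X Y"
  note P = convergence_space_prod[OF X Y]
  define I where "I = (\<lambda>f\<in>scalar_maps ?P. \<nu> (\<lambda>y\<in>points Y. \<mu> (\<lambda>x\<in>points X. f (x, y))))"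
  define J where "J = (\<lambda>f\<in>scalar_maps ?P. \<mu> (\<lambda>x\<in>points X. \<nu> (\<lambda>y\<in>points Y. f (x, y))))"
  note \<mu>' = \<mu>[unfolded continuous_linear_functional_iff[OF X]]
  note \<nu>' = \<nu>[unfolded continuous_linear_functional_iff[OF Y]]
  have I: "continuous_linear_functional ?P I"
    unfolding I_def by (rule continuous_linear_functional_iterated[OF X Y \<mu> \<nu>])
  have J: "continuous_linear_functional ?P J"
    unfolding J_def by (rule continuous_linear_functional_iterated'[OF X Y \<mu> \<nu>])
  define D where "D = (\<lambda>g. I (restrict g (points ?P)) - J (restrict g (points ?P)))"
  have D: "cover_bounded ?P D"
    unfolding D_def
    by (intro cover_bounded_diff_functional continuous_linear_functional_cover_bounded[OF P] I J)
  \<comment> \<open>On a tensor both iterated integrals factor into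
    \<open>\<mu> g * \<nu> h\<close>, so their difference vanishes.\<close>
  have tensor: "D (\<lambda>p. g (fst p) * h (snd p)) = 0" if g: "conv_cont X g" and h: "conv_cont Y h" for g h
  proof -
    let ?t = "\<lambda>p\<in>points ?P. g (fst p) * h (snd p)"
    let ?g = "\<mu> (restrict g (points X))" and ?h = "\<nu> (restrict h (points Y))"
    have t: "?t \<in> scalar_maps ?P"
      unfolding restrict_scalar_maps_iff[OF P]
      by (intro conv_cont_mult conv_cont_fst conv_cont_snd g h)
    have "\<mu> (\<lambda>x\<in>points X. ?t (x, y)) = ?g * h y" if "y \<in> points Y" for y
    proof -
      have "(\<lambda>x\<in>points X. ?t (x, y)) = (\<lambda>x\<in>points X. h y * g x)"
        using that by (intro restrict_ext) (simp add: prod_conv_space_def)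
      moreover have "\<mu> (\<lambda>x\<in>points X. h y * g x) = h y * ?g"
        using \<mu>' g by blast
      ultimately show ?thesis
        by (simp only: mult.commute)
    qed
    then have "(\<lambda>y\<in>points Y. \<mu> (\<lambda>x\<in>points X. ?t (x, y))) = (\<lambda>y\<in>points Y. ?g * h y)"
      by (rule restrict_ext)
    moreover have "\<nu> (\<lambda>y\<in>points Y. ?g * h y) = ?g * ?h"
      using \<nu>' h by blast
    ultimately have 1: "I ?t = ?g * ?h"
      using t by (simp only: I_def restrict_apply if_True)
    have "\<nu> (\<lambda>y\<in>points Y. ?t (x, y)) = ?h * g x" if "x \<in> points X" for x
    proof -
      have "(\<lambda>y\<in>points Y. ?t (x, y)) = (\<lambda>y\<in>points Y. g x * h y)"
        using that by (intro restrict_ext) (simp add: prod_conv_space_def)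
      moreover have "\<nu> (\<lambda>y\<in>points Y. g x * h y) = g x * ?h"
        using \<nu>' h by blast
      ultimately show ?thesis
        by (simp only: mult.commute)
    qed
    then have "(\<lambda>x\<in>points X. \<nu> (\<lambda>y\<in>points Y. ?t (x, y))) = (\<lambda>x\<in>points X. ?h * g x)"
      by (rule restrict_ext)
    moreover have "\<mu> (\<lambda>x\<in>points X. ?h * g x) = ?h * ?g"
      using \<mu>' g by blast
    ultimately have "J ?t = ?h * ?g"
      using t by (simp only: J_def restrict_apply if_True)
    with 1 show ?thesis
      by (simp only: D_def mult.commute[of ?h] diff_self)
  qed
  have IJ: "I f = J f" if f: "f \<in> scalar_maps ?P" for f
  proof -
    have "restrict f (points ?P) = f" "conv_cont ?P f"
      using f unfolding scalar_maps_iff[OF P] by (simp_all add: extensional_restrict)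
    then show ?thesis
      using dense[OF D tensor, of f] by (simp only: D_def right_minus_eq)
  qed
  show ?thesis
  proof (rule ex1I[of _ I], intro conjI ballI)
    show "continuous_linear_functional ?P I" by (rule I)
    fix f :: "'x \<times> 'y \<Rightarrow> 'k"
    assume f: "f \<in> scalar_maps ?P"
    show "\<nu> (\<lambda>y\<in>points Y. \<mu> (\<lambda>x\<in>points X. f (x, y))) = I f"
      using f by (simp only: I_def restrict_apply if_True)
    show "I f = \<mu> (\<lambda>x\<in>points X. \<nu> (\<lambda>y\<in>points Y. f (x, y)))"
      using f IJ[OF f] by (simp only: J_def restrict_apply if_True)
  next
    fix \<pi>
    assume \<pi>: "continuous_linear_functional ?P \<pi> \<and> (\<forall>f \<in> scalar_maps ?P.
        \<nu> (\<lambda>y\<in>points Y. \<mu> (\<lambda>x\<in>points X. f (x, y))) = \<pi> f \<and>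
        \<pi> f = \<mu> (\<lambda>x\<in>points X. \<nu> (\<lambda>y\<in>points Y. f (x, y))))"
    show "\<pi> = I"
    \<comment> \<open>The identities fix the values on all continuous maps, and extensionality fixes
      them elsewhere.\<close>
    proof (rule extensionalityI[of _ "scalar_maps ?P"])
      show "\<pi> \<in> extensional (scalar_maps ?P)"
        using \<pi> by (simp only: continuous_linear_functional_iff[OF P])
      show "I \<in> extensional (scalar_maps ?P)"
        using I by (simp only: continuous_linear_functional_iff[OF P])
      show "\<pi> f = I f" if "f \<in> scalar_maps ?P" for f
        using \<pi> that by (simp only: I_def restrict_apply if_True)
    qed
  qed
qed

theorem corollary7p6p5:
  fixes X :: "'a conv_space" and Y :: "'b conv_space"
  assumes "convergence_space X" and "convergence_space Y"
  shows
    "(\<forall>(\<mu> :: ('a \<Rightarrow> real) \<Rightarrow> real) (\<nu> :: ('b \<Rightarrow> real) \<Rightarrow> real).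
        continuous_linear_functional X \<mu> \<longrightarrow> continuous_linear_functional Y \<nu> \<longrightarrow>
        (\<exists>!\<pi>. continuous_linear_functional (prod_conv_space X Y) \<pi> \<and>
           (\<forall>f \<in> scalar_maps (prod_conv_space X Y).
              \<nu> (\<lambda>y\<in>points Y. \<mu> (\<lambda>x\<in>points X. f (x, y))) = \<pi> f \<and>
              \<pi> f = \<mu> (\<lambda>x\<in>points X. \<nu> (\<lambda>y\<in>points Y. f (x, y)))))) \<and>
     (\<forall>(\<mu> :: ('a \<Rightarrow> complex) \<Rightarrow> complex) (\<nu> :: ('b \<Rightarrow> complex) \<Rightarrow> complex).
        continuous_linear_functional X \<mu> \<longrightarrow> continuous_linear_functional Y \<nu> \<longrightarrow>
        (\<exists>!\<pi>. continuous_linear_functional (prod_conv_space X Y) \<pi> \<and>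
           (\<forall>f \<in> scalar_maps (prod_conv_space X Y).
              \<nu> (\<lambda>y\<in>points Y. \<mu> (\<lambda>x\<in>points X. f (x, y))) = \<pi> f \<and>
              \<pi> f = \<mu> (\<lambda>x\<in>points X. \<nu> (\<lambda>y\<in>points Y. f (x, y))))))"
proof (intro conjI allI impI, goal_cases)
  case (1 \<mu> \<nu>)
  show ?case
  proof (rule ex1_tensor_functional[OF assms _ 1])
    show "D f = 0"
      if "cover_bounded (prod_conv_space X Y) D"
        "\<And>g h. conv_cont X g \<Longrightarrow> conv_cont Y h \<Longrightarrow> D (\<lambda>p. g (fst p) * h (snd p)) = 0"
        "conv_cont (prod_conv_space X Y) f" for D :: "('a \<times> 'b \<Rightarrow> real) \<Rightarrow> real" and f
      by (rule cover_bounded_zero_of_tensors_real[OF assms that])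
  qed
next
  case (2 \<mu> \<nu>)
  show ?case
  proof (rule ex1_tensor_functional[OF assms _ 2])
    show "D f = 0"
      if "cover_bounded (prod_conv_space X Y) D"
        "\<And>g h. conv_cont X g \<Longrightarrow> conv_cont Y h \<Longrightarrow> D (\<lambda>p. g (fst p) * h (snd p)) = 0"
        "conv_cont (prod_conv_space X Y) f" for D :: "('a \<times> 'b \<Rightarrow> complex) \<Rightarrow> complex" and f
      by (rule cover_bounded_zero_of_tensors_complex[OF assms that])
  qed
qed

end
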